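(* Let $\varphi\in\mathfrak{G}_0$ be such that for some $\delta>0$ the set $\varphi(\mathbb{C}_0)\cap\{s:\frac12<\Re s\le\frac12+\delta\}$ is contained in a finite union of angular sectors $$\bigcup_{j=1}^d\left\{z:\left|\arg\left(z-\tfrac12-i\tau_j\right)\right|<\alpha_j\right\}$$ with $\tau_j\in\mathbb{R}$ and $\alpha_j\in(0,\pi/2)$. Then $C_\varphi$ is compact on $\mathcal{H}^2$.
   Context: For $\theta\in\mathbb{R}$, $\mathbb{C}_\theta=\{s\in\mathbb{C}:\Re s>\theta\}$. $\mathcal{H}^2$ is the Hilbert space of Dirichlet series $f(s)=\sum_{n\ge1}a_n n^{-s}$ with $\|f\|^2_{\mathcal{H}^2}=\sum_{n\ge1}|a_n|^2<\infty$ (such $f$ are holomorphic in $\mathbb{C}_{1/2}$). $\mathfrak{G}_0$ is the class of (somewhere convergent) Dirichlet series $\varphi(s)=\sum_{n\ge1}c_n n^{-s}$ that define a holomorphic function on $\mathbb{C}_0$ with $\varphi(\mathbb{C}_0)\subset\mathbb{C}_{1/2}$; for such $\varphi$, $C_\varphi f=f\circ\varphi$ is a bounded operator on $\mathcal{H}^2$. *)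

theory Defs
  imports "HOL-Complex_Analysis.Complex_Analysis"
begin

definition half_plane :: "real \<Rightarrow> complex set" where
  "half_plane \<theta> = {s. Re s > \<theta>}"

text \<open>
  The \<open>n\<close>-th term of a Dirichlet series. The index runs over all of \<^typ>\<open>nat\<close>, but the term with
  index \<open>0\<close> is \<open>0\<close> whatever \<open>a 0\<close> is, because \<open>0 powr z = 0\<close>.
\<close>

definition dirichlet_term :: "(nat \<Rightarrow> complex) \<Rightarrow> complex \<Rightarrow> nat \<Rightarrow> complex" where
  "dirichlet_term a s n = a n * of_nat n powr (- s)"

definition dirichlet_series :: "(nat \<Rightarrow> complex) \<Rightarrow> complex \<Rightarrow> complex" where
  "dirichlet_series a s = (\<Sum>n. dirichlet_term a s n)"

lemma dirichlet_term_0 [simp]: "dirichlet_term a s 0 = 0"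
  by (simp add: dirichlet_term_def)


subsection \<open>The Hilbert space of Dirichlet series with square-summable coefficients\<close>

text \<open>
  An element is given by its coefficient sequence; the unused coefficient with index \<open>0\<close> is
  normalised to \<open>0\<close>. The function it represents is \<open>h2_fun\<close> below.
\<close>

typedef h2 = "{a :: nat \<Rightarrow> complex. a 0 = 0 \<and> summable (\<lambda>n. (cmod (a n))\<^sup>2)}"
  morphisms h2_coeff Abs_h2
  by (rule exI[of _ "\<lambda>_. 0"]) simp

setup_lifting type_definition_h2

lemma h2_coeff_0 [simp]: "h2_coeff f 0 = 0"
  and summable_h2_coeff: "summable (\<lambda>n. (cmod (h2_coeff f n))\<^sup>2)"
  using h2_coeff[of f] by auto

lemma h2_eqI: "(\<And>n. h2_coeff f n = h2_coeff g n) \<Longrightarrow> f = g"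
  by (simp add: h2_coeff_inject[symmetric] fun_eq_iff)

lemma cmod_add_square_le: "(cmod (x + y))\<^sup>2 \<le> 2 * (cmod x)\<^sup>2 + 2 * (cmod y)\<^sup>2"
proof -
  have "(cmod (x + y))\<^sup>2 \<le> (cmod x + cmod y)\<^sup>2"
    by (intro power_mono norm_triangle_ineq) auto
  also have "\<dots> \<le> 2 * (cmod x)\<^sup>2 + 2 * (cmod y)\<^sup>2"
    using zero_le_power2[of "cmod x - cmod y"] by (simp add: power2_eq_square algebra_simps)
  finally show ?thesis .
qed

lemma summable_square_add:
  assumes "summable (\<lambda>n. (cmod (a n))\<^sup>2)" "summable (\<lambda>n. (cmod (b n))\<^sup>2)"
  shows "summable (\<lambda>n. (cmod (a n + b n))\<^sup>2)"
proof (rule summable_comparison_test'[where N = 0])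
  show "summable (\<lambda>n. 2 * (cmod (a n))\<^sup>2 + 2 * (cmod (b n))\<^sup>2)"
    by (intro summable_add summable_mult assms)
qed (simp add: cmod_add_square_le)

lemma summable_inner:
  assumes "summable (\<lambda>n. (cmod (a n))\<^sup>2)" "summable (\<lambda>n. (cmod (b n))\<^sup>2)"
  shows "summable (\<lambda>n. a n \<bullet> b n)"
proof (rule summable_comparison_test'[where N = 0])
  show "summable (\<lambda>n. (cmod (a n))\<^sup>2 + (cmod (b n))\<^sup>2)"
    by (intro summable_add assms)
  fix n
  have "\<bar>a n \<bullet> b n\<bar> \<le> cmod (a n) * cmod (b n)"
    by (rule Cauchy_Schwarz_ineq2)
  also have "\<dots> \<le> (cmod (a n))\<^sup>2 + (cmod (b n))\<^sup>2"
    using sum_squares_bound[of "cmod (a n)" "cmod (b n)"]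
      mult_nonneg_nonneg[of "cmod (a n)" "cmod (b n)", OF norm_ge_zero norm_ge_zero]
    by linarith
  finally show "norm (a n \<bullet> b n) \<le> (cmod (a n))\<^sup>2 + (cmod (b n))\<^sup>2" by simp
qed

text \<open>
  The library has real inner product spaces only: the inner product below is the real part of
  \<open>\<Sum>n. a n * cnj (b n)\<close>, since \<open>z \<bullet> w = Re (z * cnj w)\<close> on \<^typ>\<open>complex\<close>. The norm is the
  usual one of the complex Hilbert space.
\<close>

instantiation h2 :: real_inner
begin

lift_definition zero_h2 :: h2 is "\<lambda>_. 0" by simp

lift_definition plus_h2 :: "h2 \<Rightarrow> h2 \<Rightarrow> h2" is "\<lambda>a b n. a n + b n"
  by (simp add: summable_square_add)

lift_definition uminus_h2 :: "h2 \<Rightarrow> h2" is "\<lambda>a n. - a n" by simp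

definition minus_h2 :: "h2 \<Rightarrow> h2 \<Rightarrow> h2" where "f - g = f + (- g)" for f g :: h2

lift_definition scaleR_h2 :: "real \<Rightarrow> h2 \<Rightarrow> h2" is "\<lambda>r a n. r *\<^sub>R a n"
  by (simp add: power_mult_distrib summable_mult)

definition inner_h2 :: "h2 \<Rightarrow> h2 \<Rightarrow> real" where
  "inner_h2 f g = (\<Sum>n. h2_coeff f n \<bullet> h2_coeff g n)"

definition norm_h2 :: "h2 \<Rightarrow> real" where
  "norm_h2 f = sqrt (\<Sum>n. (cmod (h2_coeff f n))\<^sup>2)"

definition sgn_h2 :: "h2 \<Rightarrow> h2" where "sgn_h2 f = inverse (norm f) *\<^sub>R f"

definition dist_h2 :: "h2 \<Rightarrow> h2 \<Rightarrow> real" where "dist_h2 f g = norm (f - g)"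

definition uniformity_h2 :: "(h2 \<times> h2) filter" where
  "uniformity_h2 = (INF e\<in>{0<..}. principal {(x, y). dist x y < e})"

definition open_h2 :: "h2 set \<Rightarrow> bool" where
  "open_h2 U = (\<forall>x\<in>U. \<forall>\<^sub>F (x', y) in uniformity. x' = x \<longrightarrow> y \<in> U)"

instance
proof
  fix f g h :: h2 and r q :: real
  note su = summable_inner[OF summable_h2_coeff summable_h2_coeff]
  have coeff_add: "h2_coeff (f + g) n = h2_coeff f n + h2_coeff g n" for f g n
    by transfer simp
  have coeff_scale: "h2_coeff (r *\<^sub>R f) n = r *\<^sub>R h2_coeff f n" for r f n
    by transfer simp
  have coeff_zero: "h2_coeff 0 n = 0" for n by transfer simp
  show "f + g + h = f + (g + h)" by transfer (simp add: algebra_simps)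
  show "f + g = g + f" by transfer (simp add: algebra_simps)
  show "0 + f = f" by transfer simp
  show "- f + f = 0" by transfer simp
  show "f - g = f + - g" by (simp add: minus_h2_def)
  show "r *\<^sub>R (f + g) = r *\<^sub>R f + r *\<^sub>R g" by transfer (simp add: algebra_simps)
  show "(r + q) *\<^sub>R f = r *\<^sub>R f + q *\<^sub>R f" by transfer (simp add: algebra_simps)
  show "r *\<^sub>R q *\<^sub>R f = (r * q) *\<^sub>R f" by transfer simp
  show "1 *\<^sub>R f = f" by transfer simp
  show "sgn f = inverse (norm f) *\<^sub>R f" by (simp add: sgn_h2_def)
  show "dist f g = norm (f - g)" by (simp add: dist_h2_def)
  show "uniformity = (INF e\<in>{0<..}. principal {(x, y :: h2). dist x y < e})"
    by (simp add: uniformity_h2_def)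
  show "open U = (\<forall>x\<in>U. \<forall>\<^sub>F (x', y) in uniformity. x' = x \<longrightarrow> y \<in> U)" for U :: "h2 set"
    by (simp add: open_h2_def)
  show "f \<bullet> g = g \<bullet> f" by (simp add: inner_h2_def inner_commute)
  show "(f + g) \<bullet> h = f \<bullet> h + g \<bullet> h"
    by (simp add: inner_h2_def coeff_add inner_add_left suminf_add[OF su su])
  show "(r *\<^sub>R f) \<bullet> g = r * (f \<bullet> g)"
    by (simp add: inner_h2_def coeff_scale suminf_mult[OF su])
  show "0 \<le> f \<bullet> f"
    unfolding inner_h2_def by (intro suminf_nonneg su) simp
  show "(f \<bullet> f = 0) = (f = 0)"
  proof
    assume "f \<bullet> f = 0"
    then have "h2_coeff f n \<bullet> h2_coeff f n = 0" for n
      using suminf_eq_zero_iff[OF su[of f f]] by (simp add: inner_h2_def)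
    then show "f = 0" by (intro h2_eqI) (simp add: coeff_zero)
  qed (simp add: inner_h2_def coeff_zero)
  show "norm f = sqrt (f \<bullet> f)"
    by (simp add: norm_h2_def inner_h2_def power2_norm_eq_inner)
qed

end

lemma h2_coeff_diff: "h2_coeff (f - g) n = h2_coeff f n - h2_coeff g n"
  unfolding minus_h2_def by transfer simp

lemma norm_h2_coeff_le: "cmod (h2_coeff f n) \<le> norm f"
  unfolding norm_h2_def
  by (rule real_le_rsqrt)
     (use sum_le_suminf[OF summable_h2_coeff, of "{n}" f] in simp)

instance h2 :: complete_space
proof
  fix X :: "nat \<Rightarrow> h2"
  assume X: "Cauchy X"
  have "Cauchy (\<lambda>m. h2_coeff (X m) n)" for n
  proof (rule metric_CauchyI)
    fix e :: real assume "e > 0"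
    then obtain M where M: "\<And>i j. i \<ge> M \<Longrightarrow> j \<ge> M \<Longrightarrow> dist (X i) (X j) < e"
      using metric_CauchyD[OF X] by blast
    show "\<exists>M. \<forall>i\<ge>M. \<forall>j\<ge>M. dist (h2_coeff (X i) n) (h2_coeff (X j) n) < e"
      using M le_less_trans[OF norm_h2_coeff_le[of "X i - X j" n for i j]]
      by (intro exI[of _ M]) (simp add: dist_norm h2_coeff_diff)
  qed
  then have "\<forall>n. \<exists>l. (\<lambda>m. h2_coeff (X m) n) \<longlonglongrightarrow> l"
    by (simp add: Cauchy_convergent_iff convergent_def)
  then obtain a where a: "\<And>n. (\<lambda>m. h2_coeff (X m) n) \<longlonglongrightarrow> a n" by metis
  have a0: "a 0 = 0" using LIMSEQ_unique[OF a[of 0]] by simp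
  have key: "summable (\<lambda>n. (cmod (h2_coeff (X i) n - a n))\<^sup>2)
      \<and> (\<Sum>n. (cmod (h2_coeff (X i) n - a n))\<^sup>2) \<le> e\<^sup>2"
    if "e > 0" and M: "\<And>j. j \<ge> M \<Longrightarrow> dist (X i) (X j) < e" for e i M
  proof -
    have part: "(\<Sum>n<K. (cmod (h2_coeff (X i) n - a n))\<^sup>2) \<le> e\<^sup>2" for K
    proof (rule LIMSEQ_le_const2)
      show "(\<lambda>j. \<Sum>n<K. (cmod (h2_coeff (X i) n - h2_coeff (X j) n))\<^sup>2)
          \<longlonglongrightarrow> (\<Sum>n<K. (cmod (h2_coeff (X i) n - a n))\<^sup>2)"
        by (intro tendsto_intros a)
      have "(\<Sum>n<K. (cmod (h2_coeff (X i) n - h2_coeff (X j) n))\<^sup>2) \<le> e\<^sup>2" if "j \<ge> M" for j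
      proof -
        have "(\<Sum>n<K. (cmod (h2_coeff (X i - X j) n))\<^sup>2)
            \<le> (\<Sum>n. (cmod (h2_coeff (X i - X j) n))\<^sup>2)"
          by (intro sum_le_suminf summable_h2_coeff) auto
        also have "\<dots> = (norm (X i - X j))\<^sup>2"
          unfolding norm_h2_def
          by (rule real_sqrt_pow2[symmetric]) (intro suminf_nonneg summable_h2_coeff, simp)
        also have "\<dots> \<le> e\<^sup>2"
          using M[OF that] by (intro power_mono) (auto simp: dist_norm)
        finally show ?thesis by (simp add: h2_coeff_diff)
      qed
      then show "\<exists>N. \<forall>j\<ge>N. (\<Sum>n<K. (cmod (h2_coeff (X i) n - h2_coeff (X j) n))\<^sup>2) \<le> e\<^sup>2"
        by blast
    qed
    have s: "summable (\<lambda>n. (cmod (h2_coeff (X i) n - a n))\<^sup>2)"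
      by (rule summableI_nonneg_bounded[OF _ part]) simp
    then show ?thesis using part by (auto intro: suminf_le_const)
  qed
  obtain M where "\<And>j. j \<ge> M \<Longrightarrow> dist (X M) (X j) < 1"
    using metric_CauchyD[OF X, of 1] by (metis order_refl zero_less_one)
  from key[OF zero_less_one this]
  have "summable (\<lambda>n. (cmod (h2_coeff (X M) n - a n))\<^sup>2)" by blast
  then have "summable (\<lambda>n. (cmod (a n - h2_coeff (X M) n))\<^sup>2)" by (simp add: norm_minus_commute)
  from summable_square_add[OF this summable_h2_coeff[of "X M"]]
  have sa: "summable (\<lambda>n. (cmod (a n))\<^sup>2)" by simp
  define L where "L = Abs_h2 a"
  have L: "h2_coeff L = a" unfolding L_def using a0 sa by (simp add: Abs_h2_inverse)
  have "X \<longlonglongrightarrow> L"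
  proof (rule metric_LIMSEQ_I)
    fix e :: real assume e: "e > 0"
    then obtain M where M: "\<And>i j. i \<ge> M \<Longrightarrow> j \<ge> M \<Longrightarrow> dist (X i) (X j) < e / 2"
      using metric_CauchyD[OF X, of "e / 2"] by auto
    have "dist (X i) L < e" if "i \<ge> M" for i
    proof -
      have "norm (X i - L) \<le> sqrt ((e / 2)\<^sup>2)"
        unfolding norm_h2_def h2_coeff_diff L
        by (rule real_sqrt_le_mono) (use key[of "e / 2" M i] M that e in auto)
      then show ?thesis using e by (simp add: dist_norm)
    qed
    then show "\<exists>N. \<forall>i\<ge>N. dist (X i) L < e" by blast
  qed
  then show "convergent X" by (auto simp: convergent_def)
qed

text \<open>Only the values on \<open>half_plane (1 / 2)\<close>, where the series converges, are meaningful.\<close>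

definition h2_fun :: "h2 \<Rightarrow> complex \<Rightarrow> complex" where
  "h2_fun f = dirichlet_series (h2_coeff f)"


subsection \<open>Symbols and composition operators\<close>

text \<open>
  The series itself need not converge on all of \<open>half_plane 0\<close>; there the symbol is the holomorphic
  continuation of its sum. Values of \<open>\<phi>\<close> off \<open>half_plane 0\<close> are irrelevant.
\<close>

definition symbol_class_G0 :: "(complex \<Rightarrow> complex) set" where
  "symbol_class_G0 = {\<phi>.
     \<phi> holomorphic_on half_plane 0 \<and>
     \<phi> ` half_plane 0 \<subseteq> half_plane (1 / 2) \<and>
     (\<exists>c. (\<exists>s. summable (dirichlet_term c s)) \<and>
          (\<forall>s\<in>half_plane 0. summable (dirichlet_term c s) \<longrightarrow> \<phi> s = dirichlet_series c s))}"

text \<open>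
  \<open>f \<circ> \<phi>\<close> is defined on \<open>half_plane 0\<close>; as an element of \<^typ>\<open>h2\<close> it is determined by its values
  on the smaller half-plane on which elements of \<^typ>\<open>h2\<close> are given by their series.
\<close>

definition composition_operator :: "(complex \<Rightarrow> complex) \<Rightarrow> h2 \<Rightarrow> h2" where
  "composition_operator \<phi> f =
     (THE g. \<forall>s\<in>half_plane (1 / 2). h2_fun g s = h2_fun f (\<phi> s))"

definition compact_operator :: "('a::real_normed_vector \<Rightarrow> 'b::real_normed_vector) \<Rightarrow> bool" where
  "compact_operator T \<longleftrightarrow> bounded_linear T \<and> compact (closure (T ` cball 0 1))"

text \<open>
  The vertex is excluded explicitly, because \<open>Arg 0 = 0\<close>.
\<close>

definition angular_sector :: "complex \<Rightarrow> real \<Rightarrow> complex set" where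
  "angular_sector w \<alpha> = {z. z \<noteq> w \<and> \<bar>Arg (z - w)\<bar> < \<alpha>}"

end

theory Submission
  imports Defs
begin

text \<open>
  The composition operator is even Hilbert--Schmidt. Writing \<open>f \<circ> \<phi> = \<Sum>n. a n * n powr (- \<phi>)\<close> and expanding
  each power as a Dirichlet series \<open>n powr (- \<phi> s) = \<Sum>m. b n m * m powr (- s)\<close>, one sees that the operator
  acts on coefficients by the matrix \<open>b\<close>. The expansion exists far to the right because the exponential of
  an absolutely convergent Dirichlet series is one (\<open>dirichlet_series_exp\<close>). If the squares of all entries
  have a finite sum, the series of the rows represent the powers on all of \<open>half_plane (1 / 2)\<close>, the matrix
  represents \<open>f \<circ> \<phi>\<close> (\<open>h2_fun_matrix_operator\<close>), and the image of the unit ball lies in a Hilbert cube, so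
  that the operator is compact (\<open>compact_matrix_operator\<close>).

  It remains to bound \<open>\<Sum>n. \<Sum>m. \<bar>b n m\<bar>\<^sup>2\<close>. The function \<open>n powr (- \<phi>)\<close> is bounded and holomorphic on
  \<open>half_plane 0\<close>, and Bessel's inequality (\<open>bessel_inequality_dirichlet\<close>) bounds \<open>\<Sum>m. \<bar>b n m\<bar>\<^sup>2\<close> by the mean of
  \<open>n powr (- 2 Re \<phi>)\<close> along vertical lines \<open>Re s = \<sigma>\<close> with \<open>\<sigma> > 0\<close>, up to letting \<open>\<sigma>\<close> tend to \<open>0\<close>. Summation
  over \<open>n\<close> gives the mean of \<open>\<zeta> (2 Re \<phi>) \<le> 1 + 1 / (2 Re \<phi> - 1)\<close>. This is where the sectors enter: if \<open>z\<close>
  lies in a sector with vertex \<open>w\<close> on the line \<open>Re z = 1 / 2\<close> and half-angle \<open>\<alpha> < \<pi> / 2\<close>, then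
  \<open>1 / (Re z - 1 / 2) \<le> Re (1 / (z - w)) / (cos \<alpha>)\<^sup>2\<close>. So the singular part is dominated by finitely many
  positive harmonic functions \<open>Re (1 / (\<phi> - w))\<close>, and the mean of such a function along a line is its value
  far to the right. That value is bounded since \<open>\<phi>\<close> has its limit at \<open>+\<infinity>\<close> in the open half-plane
  (\<open>symbol_limit_interior\<close>). The result is \<open>symbol_hilbert_schmidt\<close>.

  Means are taken against the Cauchy distribution of scale \<open>T\<close>, with \<open>T\<close> tending to infinity. For a bounded
  holomorphic function on the half-plane the mean is then exactly the value at distance \<open>T\<close> from the line
  (\<open>integral_cauchy_law_vertical_line\<close>), which yields orthogonality of the functions \<open>m powr (- s)\<close>, Bessel's
  inequality and the means of harmonic functions at once.
\<close>

section \<open>Means along vertical lines\<close>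

text \<open>
  The Cauchy distribution of scale \<open>T\<close>, with density \<open>T / (\<pi> (T\<^sup>2 + t\<^sup>2))\<close>. It is introduced as the image of the
  uniform distribution on the unit interval because it then is the image of the normalised arc
  length of the unit circle under a Cayley transform, which maps the circle to a vertical line.
\<close>

definition cauchy_law :: "real \<Rightarrow> real measure" where
  "cauchy_law T = distr (restrict_space lborel {0<..<1}) borel (\<lambda>x. T * cot (pi * x))"

lemma sets_cauchy_law [simp, measurable_cong]: "sets (cauchy_law T) = sets borel"
  and space_cauchy_law [simp]: "space (cauchy_law T) = UNIV"
  by (simp_all add: cauchy_law_def)

lemma measurable_scaled_cot [measurable]:
  "(\<lambda>x. T * cot (pi * x)) \<in> borel_measurable (restrict_space lborel {0<..<1})"
  unfolding cot_def by (intro measurable_restrict_space1) measurable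

lemma finite_measure_unit_interval: "finite_measure (restrict_space lborel {0<..<1::real})"
  by (rule finite_measureI) (simp add: emeasure_restrict_space space_restrict_space)

lemma measure_cauchy_law [simp]: "measure (cauchy_law T) UNIV = 1"
  unfolding cauchy_law_def
  by (subst measure_distr) (auto simp: space_restrict_space measure_restrict_space)

lemma finite_measure_cauchy_law: "finite_measure (cauchy_law T)"
  unfolding cauchy_law_def
  by (intro finite_measure.finite_measure_distr finite_measure_unit_interval) measurable

lemma integrable_cauchy_law:
  fixes F :: "real \<Rightarrow> 'a :: {banach, second_countable_topology}"
  assumes "continuous_on UNIV F" "\<And>t. norm (F t) \<le> K"
  shows "integrable (cauchy_law T) F"
  using assms borel_measurable_continuous_onI[OF assms(1)]
  by (intro finite_measure.integrable_const_bound[OF finite_measure_cauchy_law, where B = K])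
     (auto simp: cauchy_law_def)

text \<open>
  The Cauchy integral formula at the centre of a circle, with the circle parametrised over \<open>{0..1}\<close>.
\<close>

lemma circle_mean_value:
  assumes f: "f holomorphic_on ball 0 1" and r: "0 < r" "r < 1"
  shows "((\<lambda>x. f (of_real r * cis (2 * pi * x))) has_integral f 0) {0..1}"
proof -
  have "f holomorphic_on cball 0 r"
    using f r by (auto elim!: holomorphic_on_subset)
  from Cauchy_integral_circlepath_simple[OF this, of 0]
  have "((\<lambda>u. f u / u) has_contour_integral 2 * of_real pi * \<i> * f 0) (circlepath 0 r)"
    using r by simp
  then have "((\<lambda>x. f (circlepath 0 r x) / circlepath 0 r x * (2 * pi * \<i> * r * exp (2 * of_real pi * \<i> * x)))
      has_integral 2 * of_real pi * \<i> * f 0) {0..1}"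
    unfolding has_contour_integral_def
    by (rule has_integral_eq[rotated]) (simp add: vector_derivative_circlepath01 of_real_mult)
  then have "((\<lambda>x. (2 * pi * \<i>) * f (of_real r * cis (2 * pi * x)))
      has_integral (2 * pi * \<i>) * f 0) {0..1}"
    by (rule has_integral_eq[rotated, THEN has_integral_eq_rhs]) (use r in \<open>auto simp: circlepath cis_conv_exp mult_ac\<close>)
  from has_integral_mult_right[OF this, of "inverse (2 * pi * \<i>)"] show ?thesis
    by (simp add: field_simps)
qed

lemma cayley_cis:
  assumes "0 < x" "x < 1"
  shows "(1 + cis (2 * pi * x)) / (1 - cis (2 * pi * x)) = \<i> * cot (pi * x)"
proof -
  define y where "y = pi * x"
  have s: "sin y \<noteq> 0"
    using assms sin_gt_zero[of y] by (simp add: y_def)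
  have p: "1 + cis (2 * y) = 2 * cos y * cis y"
    by (simp add: complex_eq_iff cos_double_cos sin_double power2_eq_square)
  have m: "1 - cis (2 * y) = - 2 * \<i> * sin y * cis y"
    by (simp add: complex_eq_iff cos_double_sin sin_double power2_eq_square)
  have "(1 + cis (2 * y)) / (1 - cis (2 * y)) = \<i> * cot y"
    unfolding p m using s by (simp add: cot_def field_simps)
  then show ?thesis by (simp add: y_def mult.assoc)
qed

lemma Re_cayley: "Re ((1 + z) / (1 - z)) = (1 - (cmod z)\<^sup>2) / (cmod (1 - z))\<^sup>2"
  unfolding Re_divide cmod_power2 by (simp add: power2_eq_square algebra_simps)

lemma Re_cayley_pos:
  assumes "cmod z < 1"
  shows "Re ((1 + z) / (1 - z)) > 0"
proof -
  have "z \<noteq> 1" "(cmod z)\<^sup>2 < 1" using assms by (auto simp: abs_square_less_1)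
  then show ?thesis unfolding Re_cayley by simp
qed

lemma Re_cayley_nonneg:
  assumes "cmod z \<le> 1"
  shows "Re ((1 + z) / (1 - z)) \<ge> 0"
  using assms unfolding Re_cayley by (simp add: abs_square_le_1)

text \<open>
  The Poisson formula at the point \<open>\<sigma> + T\<close>. The map \<open>z \<mapsto> \<sigma> + T (1 + z) / (1 - z)\<close> takes the unit disc to the
  half-plane and its centre to \<open>\<sigma> + T\<close>, so the formula is the mean value property on circles of radius
  \<open>r < 1\<close> in the limit \<open>r \<rightarrow> 1\<close>. Boundedness supplies the dominating function; the point \<open>1\<close> of the
  circle, which corresponds to infinity, has measure zero. Letting \<open>T\<close> tend to infinity turns means
  along the line into limits at the far right end of the half-plane.
\<close>

theorem integral_cauchy_law_vertical_line:
  assumes cont: "continuous_on {s. Re s \<ge> \<sigma>} G" and hol: "G holomorphic_on half_plane \<sigma>"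
    and bdd: "\<And>s. Re s \<ge> \<sigma> \<Longrightarrow> cmod (G s) \<le> K" and T: "T > 0"
  shows "(LINT t|cauchy_law T. G (Complex \<sigma> t)) = G (of_real (\<sigma> + T))"
proof -
  define \<psi> where "\<psi> z = of_real \<sigma> + of_real T * ((1 + z) / (1 - z))" for z :: complex
  define f where "f = G \<circ> \<psi>"
  have Re_psi: "Re (\<psi> z) = \<sigma> + T * Re ((1 + z) / (1 - z))" for z
  proof -
    have "Re (of_real \<sigma> + of_real T * w) = \<sigma> + T * Re w" for w by simp
    then show ?thesis unfolding \<psi>_def .
  qed
  have "f holomorphic_on ball 0 1" unfolding f_def
  proof (rule holomorphic_on_compose_gen[OF _ hol])
    show "\<psi> holomorphic_on ball 0 1" unfolding \<psi>_def by (intro holomorphic_intros) auto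
    show "\<psi> ` ball 0 1 \<subseteq> half_plane \<sigma>"
      using T Re_cayley_pos by (auto simp: half_plane_def Re_psi)
  qed
  note mean = circle_mean_value[OF this]
  \<comment> \<open>Any radii in \<open>(0, 1)\<close> tending to \<open>1\<close> will do.\<close>
  define r where "r k = 1 - 1 / (real k + 2)" for k :: nat
  have r: "0 < r k" "r k < 1" for k by (auto simp: r_def field_simps)
  have r_lim: "r \<longlonglongrightarrow> 1" unfolding r_def by real_asymp
  define F where "F k x = f (of_real (r k) * cis (2 * pi * x))" for k x
  have F: "(F k has_integral f 0) {0<..<1}" for k
    using mean[OF r] unfolding F_def has_integral_Icc_iff_Ioo .
  have F_lim: "(\<lambda>k. F k x) \<longlonglongrightarrow> G (Complex \<sigma> (T * cot (pi * x)))" if x: "x \<in> {0<..<1}" for x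
  proof -
    have ne: "cis (2 * pi * x) \<noteq> 1"
    proof
      assume "cis (2 * pi * x) = 1"
      then have "cos (2 * (pi * x)) = 1" by (simp add: complex_eq_iff mult_ac)
      then have "sin (pi * x) = 0" by (simp add: cos_double_sin)
      moreover have "sin (pi * x) > 0" using x by (intro sin_gt_zero) auto
      ultimately show False by simp
    qed
    have lim: "(\<lambda>k. \<psi> (of_real (r k) * cis (2 * pi * x))) \<longlonglongrightarrow> \<psi> (1 * cis (2 * pi * x))"
      unfolding \<psi>_def using ne r_lim tendsto_of_real[OF r_lim, where ?'a = complex] by (intro tendsto_intros) auto
    have psi: "\<psi> (1 * cis (2 * pi * x)) = Complex \<sigma> (T * cot (pi * x))"
      using x by (simp add: \<psi>_def cayley_cis complex_eq_iff)
    have in_hp: "Re (\<psi> (of_real (r k) * cis (2 * pi * x))) \<ge> \<sigma>" for k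
      unfolding Re_psi using T r[of k] Re_cayley_nonneg[of "of_real (r k) * cis (2 * pi * x)"]
      by (simp add: norm_mult)
    show ?thesis unfolding F_def f_def o_def
      by (rule continuous_on_tendsto_compose[OF cont lim[unfolded psi]]) (use in_hp in auto)
  qed
  have F_le: "norm (F k x) \<le> K" for k x
    unfolding F_def f_def o_def using T r[of k]
    by (intro bdd) (auto simp: Re_psi norm_mult intro!: mult_nonneg_nonneg Re_cayley_nonneg)
  have lim_int: "(\<lambda>k. integral {0<..<1} (F k)) \<longlonglongrightarrow> integral {0<..<1} (\<lambda>x. G (Complex \<sigma> (T * cot (pi * x))))"
  proof (rule dominated_convergence(2))
    show "F k integrable_on {0<..<1}" for k using F by blast
    show "(\<lambda>x::real. K) integrable_on {0<..<1}"
      using integrable_const_ivl[where a = 0 and b = "1::real" and c = K] by (simp add: integrable_on_Icc_iff_Ioo)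
  qed (use F_le F_lim in auto)
  moreover have "integral {0<..<1} (F k) = f 0" for k using F by (simp add: integral_unique)
  ultimately have eq: "integral {0<..<1} (\<lambda>x. G (Complex \<sigma> (T * cot (pi * x)))) = f 0"
    by (simp add: LIMSEQ_const_iff)
  have cont_line: "continuous_on UNIV (\<lambda>t. G (Complex \<sigma> t))"
    by (rule continuous_on_compose2[OF cont]) (auto intro!: continuous_intros simp: Complex_eq)
  have "(LINT t|cauchy_law T. G (Complex \<sigma> t))
     = (LINT x|restrict_space lborel {0<..<1}. G (Complex \<sigma> (T * cot (pi * x))))"
    unfolding cauchy_law_def
    by (rule integral_distr) (auto intro: borel_measurable_continuous_onI cont_line)
  also have "\<dots> = (LINT x:{0<..<1}|lborel. G (Complex \<sigma> (T * cot (pi * x))))"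
    by (simp add: integral_restrict_space set_lebesgue_integral_def)
  also have "\<dots> = integral {0<..<1} (\<lambda>x. G (Complex \<sigma> (T * cot (pi * x))))"
  proof (rule set_borel_integral_eq_integral)
    have "integrable (restrict_space lborel {0<..<1}) (\<lambda>x. G (Complex \<sigma> (T * cot (pi * x))))"
      using integrable_cauchy_law[OF cont_line, of K T] bdd
      by (intro integrable_distr[OF measurable_scaled_cot[of T]]) (simp add: cauchy_law_def)
    then show "set_integrable lborel {0<..<1} (\<lambda>x. G (Complex \<sigma> (T * cot (pi * x))))"
      by (simp add: set_integrable_def integrable_restrict_space)
  qed
  also have "\<dots> = G (of_real (\<sigma> + T))" unfolding eq by (simp add: f_def \<psi>_def)
  finally show ?thesis .
qed

section \<open>Exponentials of Dirichlet series\<close>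

text \<open>
  Powers of a series are expanded over lists of indices, rather than by iterated convolution: a term of
  the \<open>k\<close>-th power is the product over a list of length \<open>k\<close>. The version for nonnegative reals provides
  the absolute convergence that the complex version needs.
\<close>

lemma has_sum_prod_list_real:
  fixes w :: "'i \<Rightarrow> real"
  assumes "(w has_sum W) UNIV" "\<And>i. w i \<ge> 0"
  shows "((\<lambda>xs. prod_list (map w xs)) has_sum W ^ k) {xs. length xs = k}"
proof (induction k)
  case 0
  have "{xs :: 'i list. length xs = 0} = {[]}" by auto
  then show ?case by (simp add: has_sum_finite_iff)
next
  case (Suc k)
  have nonneg: "prod_list (map w xs) \<ge> 0" for xs
    using assms(2) by (induction xs) auto
  have inner: "((\<lambda>xs. case (i, xs) of (i, xs) \<Rightarrow> w i * prod_list (map w xs)) has_sum w i * W ^ k) {xs. length xs = k}" for i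
    by (simp add: has_sum_cmult_right Suc.IH)
  have outer: "((\<lambda>i. w i * W ^ k) has_sum W * W ^ k) UNIV"
    by (intro has_sum_cmult_left assms)
  have "((\<lambda>(i, xs). w i * prod_list (map w xs)) has_sum W * W ^ k) (UNIV \<times> {xs. length xs = k})"
    by (rule has_sum_SigmaI[OF inner outer], rule summable_on_SigmaI[OF inner])
       (use outer assms nonneg in \<open>auto simp: summable_on_def\<close>)
  also have "?this \<longleftrightarrow> ?case"
    by (rule has_sum_reindex_bij_witness[where j = "\<lambda>(i, xs). i # xs" and i = "\<lambda>xs. (hd xs, tl xs)"])
       (auto simp: length_Suc_conv)
  finally show ?case .
qed

lemma norm_prod_list_map: "norm (prod_list (map z xs)) = prod_list (map (\<lambda>i. norm (z i)) xs)"
  for z :: "'i \<Rightarrow> complex"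
  by (induction xs) (auto simp: norm_mult)

lemma has_sum_prod_list:
  fixes z :: "'i \<Rightarrow> complex"
  assumes "(z has_sum Z) UNIV"
  shows "((\<lambda>xs. prod_list (map z xs)) has_sum Z ^ k) {xs. length xs = k}"
proof (induction k)
  case 0
  have "{xs :: 'i list. length xs = 0} = {[]}" by auto
  then show ?case by (simp add: has_sum_finite_iff)
next
  case (Suc k)
  have inner: "((\<lambda>xs. case (i, xs) of (i, xs) \<Rightarrow> z i * prod_list (map z xs)) has_sum z i * Z ^ k) {xs. length xs = k}" for i
    by (simp add: has_sum_cmult_right Suc.IH)
  have outer: "((\<lambda>i. z i * Z ^ k) has_sum Z * Z ^ k) UNIV"
    by (intro has_sum_cmult_left assms)
  have cons: "(\<lambda>(i, xs). z i * prod_list (map z xs)) summable_on UNIV \<times> {xs. length xs = k}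
      \<longleftrightarrow> (\<lambda>xs. prod_list (map z xs)) summable_on {xs. length xs = Suc k}"
    by (rule summable_on_reindex_bij_witness[where j = "\<lambda>(i, xs). i # xs" and i = "\<lambda>xs. (hd xs, tl xs)"])
       (auto simp: length_Suc_conv)
  have "(\<lambda>i. norm (z i)) summable_on UNIV"
    using assms summable_on_iff_abs_summable_on_complex by (auto simp: summable_on_def)
  note norms = has_sum_prod_list_real[OF has_sum_infsum[OF this], of "Suc k"]
  have "(\<lambda>xs. norm (prod_list (map z xs))) summable_on {xs. length xs = Suc k}"
    unfolding norm_prod_list_map by (rule has_sum_imp_summable[OF norms]) simp
  then have "(\<lambda>xs. prod_list (map z xs)) summable_on {xs. length xs = Suc k}"
    by (rule abs_summable_summable)
  then have "((\<lambda>(i, xs). z i * prod_list (map z xs)) has_sum Z * Z ^ k) (UNIV \<times> {xs. length xs = k})"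
    by (intro has_sum_SigmaI[OF inner outer] cons[THEN iffD2])
  also have "?this \<longleftrightarrow> ?case"
    by (rule has_sum_reindex_bij_witness[where j = "\<lambda>(i, xs). i # xs" and i = "\<lambda>xs. (hd xs, tl xs)"])
       (auto simp: length_Suc_conv)
  finally show ?case .
qed

lemma has_sum_exp:
  fixes z :: "'i \<Rightarrow> complex"
  assumes z: "(z has_sum Z) UNIV"
  shows "((\<lambda>xs. prod_list (map z xs) / fact (length xs)) has_sum exp Z) UNIV"
proof -
  define u where "u = (\<lambda>(k, xs). prod_list (map z xs) / fact k)"
  have nz: "(\<lambda>i. norm (z i)) summable_on UNIV"
    using assms summable_on_iff_abs_summable_on_complex by (auto simp: summable_on_def)
  define W where "W = infsum (\<lambda>i. norm (z i)) UNIV"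
  have "((\<lambda>i. norm (z i)) has_sum W) UNIV" unfolding W_def using nz by (rule has_sum_infsum)
  note W = has_sum_prod_list_real[OF this norm_ge_zero, folded norm_prod_list_map]
  have exp_sum: "((\<lambda>k. y ^ k / fact k) has_sum exp y) UNIV" for y :: "'b :: {real_normed_field, banach}"
    using norm_summable_imp_has_sum[OF summable_norm_exp exp_converges, of y]
    by (simp add: scaleR_conv_of_real divide_inverse mult.commute)
  have innW: "((\<lambda>xs. norm (u (k, xs))) has_sum W ^ k / fact k) {xs. length xs = k}" for k
    unfolding u_def using has_sum_cmult_left[OF W[where k = k], where c = "1 / fact k"] by (simp add: norm_divide)
  have inn: "((\<lambda>xs. u (k, xs)) has_sum Z ^ k / fact k) {xs. length xs = k}" for k
    unfolding u_def using has_sum_cmult_left[OF has_sum_prod_list[OF z, where k = k], where c = "1 / fact k"] by simp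
  have "(\<lambda>p. norm (u p)) summable_on (SIGMA k:UNIV. {xs. length xs = k})"
    by (rule summable_on_SigmaI[OF innW]) (use exp_sum in \<open>auto simp: summable_on_def\<close>)
  then have "u summable_on (SIGMA k:UNIV. {xs. length xs = k})"
    by (rule abs_summable_summable)
  from has_sum_SigmaI[OF inn exp_sum this]
  have "(u has_sum exp Z) (SIGMA k:UNIV. {xs. length xs = k})" .
  also have "?this \<longleftrightarrow> ?thesis"
    by (rule has_sum_reindex_bij_witness[where j = snd and i = "\<lambda>xs. (length xs, xs)"]) (auto simp: u_def)
  finally show ?thesis .
qed

text \<open>
  Since \<open>n \<mapsto> n powr (- s)\<close> is multiplicative, the terms of the expanded exponential of a Dirichlet series
  are again terms of a Dirichlet series, indexed by lists of natural numbers.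
\<close>

lemma prod_list_dirichlet_term:
  "prod_list (map (dirichlet_term c s) xs) = prod_list (map c xs) * of_nat (prod_list xs) powr (- s)"
  by (induction xs) (auto simp: dirichlet_term_def powr_times_real mult_ac)

text \<open>
  The terms of the exponential series belonging to lists with the same product \<open>m\<close> are collected into one
  coefficient \<open>b m\<close>. Absolute convergence permits the regrouping, and the resulting series converges
  absolutely on the same half-plane.
\<close>

lemma dirichlet_series_exp:
  assumes "\<And>s. Re s \<ge> \<theta> \<Longrightarrow> (dirichlet_term c s has_sum \<psi> s) UNIV"
  shows "\<exists>b. b 0 = 0 \<and> (\<forall>s. Re s \<ge> \<theta> \<longrightarrow> (dirichlet_term b s has_sum exp (\<psi> s)) UNIV)"
proof -
  define A where "A xs = prod_list (map c xs) / fact (length xs)" for xs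
  have total: "((\<lambda>xs. A xs * of_nat (prod_list xs) powr (- s)) has_sum exp (\<psi> s)) UNIV"
    if "Re s \<ge> \<theta>" for s
    using has_sum_exp[OF assms[OF that]] by (simp add: prod_list_dirichlet_term A_def)
  define fibre where "fibre m = {xs :: nat list. prod_list xs = m}" for m
  \<comment> \<open>Lists with product \<open>0\<close> contribute only zero terms.\<close>
  define b where "b m = (if m = 0 then 0 else infsum A (fibre m))" for m
  have A_sum: "A summable_on fibre m" if "m > 0" for m
  proof -
    have "(\<lambda>xs. A xs * of_nat (prod_list xs) powr (- of_real \<theta>)) summable_on fibre m"
      by (rule summable_on_subset_banach[OF has_sum_imp_summable[OF total] subset_UNIV]) simp
    also have "?this \<longleftrightarrow> (\<lambda>xs. A xs * of_nat m powr (- of_real \<theta>)) summable_on fibre m"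
      by (rule summable_on_cong) (simp add: fibre_def)
    finally show ?thesis using that summable_on_cmult_left'[of "of_nat m powr (- of_real \<theta>)" A] by auto
  qed
  have "(dirichlet_term b s has_sum exp (\<psi> s)) UNIV" if s: "Re s \<ge> \<theta>" for s
  proof -
    have inner: "((\<lambda>xs. A xs * of_nat (prod_list xs) powr (- s)) has_sum dirichlet_term b s m) (fibre m)" for m
    proof (cases "m = 0")
      case True
      then show ?thesis by (auto intro!: has_sum_0 simp: fibre_def)
    next
      case False
      then have "((\<lambda>xs. A xs * of_nat m powr (- s)) has_sum dirichlet_term b s m) (fibre m)"
        unfolding dirichlet_term_def b_def using A_sum by (auto intro!: has_sum_cmult_left)
      then show ?thesis by (rule has_sum_cong[THEN iffD1, rotated]) (simp add: fibre_def)
    qed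
    have reindex: "((\<lambda>(m, xs). A xs * of_nat (prod_list xs) powr (- s)) has_sum exp (\<psi> s)) (Sigma UNIV fibre)
      \<longleftrightarrow> ((\<lambda>xs. A xs * of_nat (prod_list xs) powr (- s)) has_sum exp (\<psi> s)) UNIV"
      by (rule has_sum_reindex_bij_witness[where j = snd and i = "\<lambda>xs. (prod_list xs, xs)"]) (auto simp: fibre_def)
    show ?thesis
      by (rule has_sum_SigmaD[OF reindex[THEN iffD2, OF total[OF s]]]) (simp add: inner)
  qed
  moreover have "b 0 = 0" by (simp add: b_def)
  ultimately show ?thesis by blast
qed

lemma norm_dirichlet_term: "cmod (dirichlet_term a s n) = cmod (a n) * real n powr (- Re s)"
  by (simp add: dirichlet_term_def norm_mult norm_powr_real_powr)

text \<open>
  At a point of convergence the terms are bounded, which costs a factor summable after moving two units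
  to the right.
\<close>

lemma dirichlet_abs_convergent:
  assumes "summable (dirichlet_term c s0)" "Re s \<ge> Re s0 + 2"
  shows "(dirichlet_term c s has_sum dirichlet_series c s) UNIV"
proof -
  have "(\<lambda>n. dirichlet_term c s0 n) \<longlonglongrightarrow> 0" using assms(1) by (rule summable_LIMSEQ_zero)
  then have "Bseq (dirichlet_term c s0)" by (intro convergent_imp_Bseq) (auto simp: convergent_def)
  then obtain K where K: "\<And>n. cmod (dirichlet_term c s0 n) \<le> K" by (auto simp: Bseq_def)
  have "summable (\<lambda>n. norm (dirichlet_term c s n))"
  proof (rule summable_comparison_test'[where N = 1])
    show "summable (\<lambda>n. K * real n powr (-2))"
      by (intro summable_mult) (simp add: summable_real_powr_iff)
    fix n :: nat assume n: "n \<ge> 1"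
    have "cmod (c n) * real n powr (- Re s) = (cmod (c n) * real n powr (- Re s0)) * real n powr (Re s0 - Re s)"
      by (simp add: powr_add[symmetric])
    also have "\<dots> \<le> K * real n powr (-2)"
      using K[of n] K[of 0] assms n by (intro mult_mono powr_mono) (auto simp: norm_dirichlet_term)
    finally show "norm (norm (dirichlet_term c s n)) \<le> K * real n powr (-2)"
      by (simp add: norm_dirichlet_term)
  qed
  then show ?thesis unfolding dirichlet_series_def
    by (intro norm_summable_imp_has_sum summable_sums) (auto dest: summable_norm_cancel)
qed

section \<open>Bessel's inequality for bounded Dirichlet series\<close>

lemma open_half_plane: "open (half_plane \<theta>)"
  unfolding half_plane_def by (simp add: open_halfspace_Re_gt)

lemma continuous_on_vertical_line:
  assumes "g holomorphic_on half_plane 0" "\<sigma> > 0"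
  shows "continuous_on UNIV (\<lambda>t. g (Complex \<sigma> t))"
  by (rule continuous_on_compose2[OF holomorphic_on_imp_continuous_on[OF assms(1)]])
     (use assms in \<open>auto intro!: continuous_intros simp: Complex_eq half_plane_def\<close>)

text \<open>
  This is the form in which the Poisson formula is used: wide means along a fixed line see only the
  behaviour at \<open>+\<infinity>\<close>.
\<close>

lemma integral_cauchy_law_tendsto:
  assumes hol: "F holomorphic_on half_plane 0" and \<sigma>: "\<sigma> > 0"
    and bdd: "\<And>s. Re s \<ge> \<sigma> \<Longrightarrow> cmod (F s) \<le> K"
    and lim: "((\<lambda>x. F (of_real x)) \<longlongrightarrow> l) at_top"
  shows "((\<lambda>T. LINT t|cauchy_law T. F (Complex \<sigma> t)) \<longlongrightarrow> l) at_top"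
proof -
  have "((\<lambda>T. F (of_real (\<sigma> + T))) \<longlongrightarrow> l) at_top"
    by (rule filterlim_compose[OF lim]) (rule filterlim_tendsto_add_at_top[OF tendsto_const filterlim_ident])
  moreover have "\<forall>\<^sub>F T in at_top. F (of_real (\<sigma> + T)) = (LINT t|cauchy_law T. F (Complex \<sigma> t))"
  proof (rule eventually_mono[OF eventually_gt_at_top[of 0]])
    fix T :: real assume "T > 0"
    show "F (of_real (\<sigma> + T)) = (LINT t|cauchy_law T. F (Complex \<sigma> t))"
    proof (rule integral_cauchy_law_vertical_line[symmetric])
      show "continuous_on {s. Re s \<ge> \<sigma>} F"
        by (rule holomorphic_on_imp_continuous_on, rule holomorphic_on_subset[OF hol])
           (use \<sigma> in \<open>auto simp: half_plane_def\<close>)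
      show "F holomorphic_on half_plane \<sigma>"
        by (rule holomorphic_on_subset[OF hol]) (use \<sigma> in \<open>auto simp: half_plane_def\<close>)
    qed (use bdd \<open>T > 0\<close> in auto)
  qed
  ultimately show ?thesis by (rule Lim_transform_eventually)
qed

lemma powr_tendsto_0_at_top:
  assumes "0 < a" "a < (1::real)"
  shows "((\<lambda>x. a powr x) \<longlongrightarrow> 0) at_top"
proof -
  have "filterlim (\<lambda>x. ln a * x) at_bot at_top"
    using assms by (intro filterlim_tendsto_neg_mult_at_bot[OF tendsto_const _ filterlim_ident]) auto
  then have "((\<lambda>x. exp (ln a * x)) \<longlongrightarrow> 0) at_top"
    by (rule filterlim_compose[OF exp_at_bot])
  also have "(\<lambda>x. exp (ln a * x)) = (\<lambda>x. a powr x)"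
    using assms by (simp add: powr_def mult.commute)
  finally show ?thesis .
qed

lemma powr_of_nat_holomorphic [holomorphic_intros]:
  "f holomorphic_on A \<Longrightarrow> (\<lambda>s. of_nat m powr f s) holomorphic_on A"
  by (cases "m = 0") (auto intro!: holomorphic_intros)

lemma cnj_of_nat_powr: "cnj (of_nat m powr s) = of_nat m powr cnj s"
  by (cases "m = 0") (auto simp: powr_def exp_cnj cnj_Ln)

lemma of_nat_powr_add: "m \<noteq> 0 \<Longrightarrow> (of_nat m :: complex) powr (s + z) = of_nat m powr s * of_nat m powr z"
  by (simp add: powr_add)

lemma norm_of_nat_powr: "cmod (of_nat m powr s) = real m powr Re s"
  by (simp add: norm_powr_real_powr)

text \<open>
  On a vertical line conjugation of \<open>m powr (- s)\<close> gives, up to a constant, the holomorphic function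
  \<open>m powr s\<close>. Hence inner products with \<open>m powr (- s)\<close> along the line are means of holomorphic functions.
\<close>

lemma cnj_dirichlet_character:
  assumes "m \<noteq> 0"
  shows "cnj (of_nat m powr (- Complex \<sigma> t)) = of_real (real m powr (-2 * \<sigma>)) * of_nat m powr Complex \<sigma> t"
proof -
  have c: "cnj (- Complex \<sigma> t) = of_real (-2 * \<sigma>) + Complex \<sigma> t"
    by (simp add: complex_eq_iff)
  have p: "(of_nat m :: complex) powr of_real (-2 * \<sigma>) = of_real (real m powr (-2 * \<sigma>))"
    using powr_of_real[of "real m" "-2 * \<sigma>"] by simp
  show ?thesis unfolding cnj_of_nat_powr c of_nat_powr_add[OF assms] p ..
qed

text \<open>
  For \<open>m < k\<close> the integrand extends to a multiple of \<open>(m / k) powr s\<close>, which is bounded and tends to \<open>0\<close> at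
  \<open>+\<infinity>\<close>; the case \<open>m > k\<close> is its conjugate.
\<close>

lemma dirichlet_characters_orthogonal:
  assumes "m \<ge> 1" "k \<ge> 1" "\<sigma> > 0"
  shows "((\<lambda>T. LINT t|cauchy_law T. of_nat k powr (- Complex \<sigma> t) * cnj (of_nat m powr (- Complex \<sigma> t)))
     \<longlongrightarrow> (if m = k then of_real (real m powr (-2 * \<sigma>)) else 0)) at_top"
proof -
  define e where "e m t = (of_nat m :: complex) powr (- Complex \<sigma> t)" for m t
  have lim: "((\<lambda>T. LINT t|cauchy_law T. e k t * cnj (e m t)) \<longlongrightarrow> 0) at_top"
    if "m < k" "m \<ge> 1" for m k :: nat
  proof -
    let ?c = "of_real (real m powr (-2 * \<sigma>)) :: complex"
    define F where "F s = ?c * (of_nat k powr (- s) * of_nat m powr s)" for s :: complex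
    have norm_F: "cmod (F s) = real m powr (-2 * \<sigma>) * (real m / real k) powr Re s" for s
      using that unfolding F_def norm_mult norm_of_nat_powr norm_of_real by (simp add: powr_divide powr_minus_divide)
    have "((\<lambda>T. LINT t|cauchy_law T. F (Complex \<sigma> t)) \<longlongrightarrow> 0) at_top"
    proof (rule integral_cauchy_law_tendsto)
      show "F holomorphic_on half_plane 0" unfolding F_def by (intro holomorphic_intros)
      show "cmod (F s) \<le> real m powr (-2 * \<sigma>) * 1" if "Re s \<ge> \<sigma>" for s
        unfolding norm_F using \<open>m < k\<close> \<open>\<sigma> > 0\<close> that by (intro mult_left_mono powr_le1) auto
      have "((\<lambda>x. real m powr (-2 * \<sigma>) * (real m / real k) powr x) \<longlongrightarrow> real m powr (-2 * \<sigma>) * 0) at_top"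
        using that by (intro tendsto_intros powr_tendsto_0_at_top) auto
      then have "((\<lambda>x. cmod (F (of_real x))) \<longlongrightarrow> 0) at_top"
        unfolding norm_F by simp
      then show "((\<lambda>x. F (of_real x)) \<longlongrightarrow> 0) at_top" by (rule tendsto_norm_zero_cancel)
    qed fact
    also have "(\<lambda>t. F (Complex \<sigma> t)) = (\<lambda>t. e k t * cnj (e m t))"
      using that unfolding F_def e_def by (subst cnj_dirichlet_character) (auto simp: mult_ac)
    finally show ?thesis .
  qed
  consider "m < k" | "k < m" | "m = k" by linarith
  then have "((\<lambda>T. LINT t|cauchy_law T. e k t * cnj (e m t))
     \<longlongrightarrow> (if m = k then of_real (real m powr (-2 * \<sigma>)) else 0)) at_top"
  proof cases
    case 1
    then show ?thesis using lim[of m k] assms by auto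
  next
    case 2
    have "((\<lambda>T. cnj (LINT t|cauchy_law T. e m t * cnj (e k t))) \<longlongrightarrow> cnj 0) at_top"
      by (intro tendsto_cnj lim) (use assms 2 in auto)
    moreover have "cnj (LINT t|cauchy_law T. e m t * cnj (e k t)) = (LINT t|cauchy_law T. e k t * cnj (e m t))" for T
      by (subst Bochner_Integration.integral_cnj[symmetric]) (simp add: mult.commute)
    ultimately have "((\<lambda>T. LINT t|cauchy_law T. e k t * cnj (e m t)) \<longlongrightarrow> 0) at_top"
      by simp
    with 2 show ?thesis by auto
  next
    case 3
    have "e m t * cnj (e m t) = of_real (real m powr (-2 * \<sigma>))" for t
    proof -
      have "e m t * cnj (e m t) = of_real ((real m powr (-\<sigma>))\<^sup>2)"
        unfolding complex_norm_square[symmetric] e_def norm_of_nat_powr by simp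
      also have "(real m powr (-\<sigma>))\<^sup>2 = real m powr (-2 * \<sigma>)"
        by (simp add: power2_eq_square flip: powr_add)
      finally show ?thesis .
    qed
    with 3 show ?thesis by (simp add: measure_cauchy_law)
  qed
  then show ?thesis unfolding e_def .
qed

text \<open>
  Far to the right, the remainder after \<open>M\<close> terms is \<open>O((M + 1) powr (- s))\<close> by absolute convergence, so
  it decays faster than \<open>m powr s\<close> grows when \<open>m \<le> M\<close>. In the strip that remains, the bound on \<open>g\<close>
  suffices; there the series itself may diverge.
\<close>

lemma dirichlet_remainder:
  assumes g: "\<And>s. s \<in> half_plane 0 \<Longrightarrow> cmod (g s) \<le> K"
    and b: "\<And>s. Re s \<ge> \<theta> \<Longrightarrow> (dirichlet_term b s has_sum g s) UNIV"
    and \<sigma>: "\<sigma> > 0" and m: "1 \<le> m" "m \<le> M"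
  defines "F \<equiv> \<lambda>s. of_nat m powr s * (g s - (\<Sum>k=1..M. dirichlet_term b s k))"
  shows "\<exists>K'. \<forall>s. Re s \<ge> \<sigma> \<longrightarrow> cmod (F s) \<le> K'"
    and "((\<lambda>x. F (of_real x)) \<longlongrightarrow> 0) at_top"
proof -
  define B where "B = infsum (\<lambda>k. cmod (dirichlet_term b (of_real \<theta>) k)) UNIV"
  have abs: "(\<lambda>k. cmod (dirichlet_term b s k)) summable_on UNIV" if "Re s \<ge> \<theta>" for s
    using b[OF that] summable_on_iff_abs_summable_on_complex by (auto simp: summable_on_def)
  have far: "cmod (F s) \<le> real (M + 1) powr \<theta> * B * (real m / real (M + 1)) powr Re s"
    if s: "Re s \<ge> \<theta>" for s
  proof -
    have "(dirichlet_term b s has_sum (g s - (\<Sum>k\<in>{..M}. dirichlet_term b s k))) (UNIV - {..M})"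
      by (rule has_sum_Diff[OF b[OF s]]) (auto intro: has_sum_finite)
    also have "(\<Sum>k\<in>{..M}. dirichlet_term b s k) = (\<Sum>k=1..M. dirichlet_term b s k)"
      by (rule sum.mono_neutral_right) (auto simp: Suc_le_eq)
    finally have R: "(dirichlet_term b s has_sum (g s - (\<Sum>k=1..M. dirichlet_term b s k))) (UNIV - {..M})" .
    have "cmod (g s - (\<Sum>k=1..M. dirichlet_term b s k))
        \<le> infsum (\<lambda>k. cmod (dirichlet_term b s k)) (UNIV - {..M})"
      using norm_infsum_bound[OF summable_on_subset_banach[OF abs[OF s]], of "UNIV - {..M}"] R
      by (simp add: infsumI)
    also have "\<dots> \<le> infsum (\<lambda>k. real (M + 1) powr (\<theta> - Re s) * cmod (dirichlet_term b (of_real \<theta>) k)) (UNIV - {..M})"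
    proof (intro infsum_mono summable_on_cmult_right)
      fix k assume "k \<in> UNIV - {..M}"
      then have k: "k \<ge> M + 1" by auto
      have "real k powr (- Re s) = real k powr (\<theta> - Re s) * real k powr (- \<theta>)"
        by (simp flip: powr_add)
      also have "\<dots> \<le> real (M + 1) powr (\<theta> - Re s) * real k powr (- \<theta>)"
        using s k by (intro mult_right_mono powr_mono2') auto
      finally have "cmod (b k) * real k powr (- Re s) \<le> cmod (b k) * (real (M + 1) powr (\<theta> - Re s) * real k powr (- \<theta>))"
        by (rule mult_left_mono) simp
      then show "cmod (dirichlet_term b s k) \<le> real (M + 1) powr (\<theta> - Re s) * cmod (dirichlet_term b (of_real \<theta>) k)"
        by (simp add: norm_dirichlet_term mult_ac)
    qed (use abs[of s] abs[of "of_real \<theta>"] s in \<open>auto intro: summable_on_subset_banach\<close>)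
    also have "\<dots> = real (M + 1) powr (\<theta> - Re s) * infsum (\<lambda>k. cmod (dirichlet_term b (of_real \<theta>) k)) (UNIV - {..M})"
      by (rule infsum_cmult_right')
    also have "\<dots> \<le> real (M + 1) powr (\<theta> - Re s) * B" unfolding B_def
      using abs[of "of_real \<theta>"]
      by (intro mult_left_mono infsum_mono_neutral) (auto intro: summable_on_subset_banach)
    finally have "cmod (F s) \<le> real m powr Re s * (real (M + 1) powr (\<theta> - Re s) * B)"
      unfolding F_def norm_mult norm_of_nat_powr by (rule mult_left_mono) simp
    also have "\<dots> = real (M + 1) powr \<theta> * B * (real m / real (M + 1)) powr Re s"
      by (simp add: powr_divide powr_diff)
    finally show ?thesis .
  qed
  have B: "B \<ge> 0" unfolding B_def by (intro infsum_nonneg) auto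
  have near: "cmod (F s) \<le> real m powr \<theta> * (K + (\<Sum>k=1..M. cmod (b k)))"
    if s: "Re s \<ge> \<sigma>" "Re s \<le> \<theta>" for s
  proof -
    have "cmod (dirichlet_term b s k) \<le> cmod (b k) * 1" if "k \<in> {1..M}" for k
      unfolding norm_dirichlet_term using that s \<sigma> powr_mono[of "- Re s" 0 "real k"]
      by (intro mult_left_mono) auto
    then have "cmod (\<Sum>k=1..M. dirichlet_term b s k) \<le> (\<Sum>k=1..M. cmod (b k))"
      by (intro sum_norm_le) auto
    moreover have "cmod (g s) \<le> K" using g s \<sigma> by (auto simp: half_plane_def)
    ultimately have "cmod (g s - (\<Sum>k=1..M. dirichlet_term b s k)) \<le> K + (\<Sum>k=1..M. cmod (b k))"
      by (intro order.trans[OF norm_triangle_ineq4] add_mono)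
    then show ?thesis unfolding F_def norm_mult norm_of_nat_powr
      using m s by (intro mult_mono powr_mono) auto
  qed
  show "\<exists>K'. \<forall>s. Re s \<ge> \<sigma> \<longrightarrow> cmod (F s) \<le> K'"
  proof (intro exI allI impI)
    fix s assume s: "Re s \<ge> \<sigma>"
    show "cmod (F s) \<le> max (real (M + 1) powr \<theta> * B) (real m powr \<theta> * (K + (\<Sum>k=1..M. cmod (b k))))"
    proof (cases "Re s \<le> \<theta>")
      case True
      then show ?thesis using near[OF s] by auto
    next
      case False
      have "cmod (F s) \<le> real (M + 1) powr \<theta> * B * (real m / real (M + 1)) powr Re s"
        using False by (intro far) auto
      also have "\<dots> \<le> real (M + 1) powr \<theta> * B * 1"
        using s \<sigma> m B by (intro mult_left_mono powr_le1) auto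
      finally show ?thesis by simp
    qed
  qed
  have "((\<lambda>x. real (M + 1) powr \<theta> * B * (real m / real (M + 1)) powr x) \<longlongrightarrow> real (M + 1) powr \<theta> * B * 0) at_top"
    using m by (intro tendsto_intros powr_tendsto_0_at_top) auto
  then have lim: "((\<lambda>x. real (M + 1) powr \<theta> * B * (real m / real (M + 1)) powr x) \<longlongrightarrow> 0) at_top"
    by simp
  show "((\<lambda>x. F (of_real x)) \<longlongrightarrow> 0) at_top"
  proof (rule Lim_null_comparison[OF _ lim], rule eventually_mono[OF eventually_ge_at_top[of \<theta>]])
    fix x assume "x \<ge> \<theta>"
    then show "cmod (F (of_real x)) \<le> real (M + 1) powr \<theta> * B * (real m / real (M + 1)) powr x"
      using far[of "of_real x"] by simp
  qed
qed

lemma dirichlet_coefficient_limit: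
  assumes g: "\<And>s. s \<in> half_plane 0 \<Longrightarrow> cmod (g s) \<le> K"
    and b: "\<And>s. Re s \<ge> \<theta> \<Longrightarrow> (dirichlet_term b s has_sum g s) UNIV"
  shows "((\<lambda>x. g (of_real x)) \<longlongrightarrow> b 1) at_top"
  using dirichlet_remainder(2)[OF g b zero_less_one, where m = 1 and M = 1]
  by (simp add: dirichlet_term_def Lim_null[symmetric])

text \<open>
  Bessel's inequality in the half-plane where \<open>g\<close> is bounded, although the series is known to converge
  only to the right of \<open>\<theta>\<close>. Let \<open>P\<close> be the partial sum with \<open>M\<close> terms. By orthogonality the means of
  \<open>\<bar>P\<bar>\<^sup>2\<close> tend to the left-hand side. The means of \<open>(g - P) cnj P\<close> tend to \<open>0\<close>, because they are
  linear combinations of means of the bounded holomorphic functions \<open>m powr s (g s - P s)\<close>, which vanish at \<open>+\<infinity>\<close>. The claim follows from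
  \<open>0 \<le> \<bar>g - P\<bar>\<^sup>2\<close>. The error \<open>E\<close> is kept explicit so that inequalities for several functions can be added
  before \<open>T\<close> tends to infinity.
\<close>

theorem bessel_inequality_dirichlet:
  assumes hol: "g holomorphic_on half_plane 0"
    and g: "\<And>s. s \<in> half_plane 0 \<Longrightarrow> cmod (g s) \<le> K"
    and b: "\<And>s. Re s \<ge> \<theta> \<Longrightarrow> (dirichlet_term b s has_sum g s) UNIV"
    and \<sigma>: "\<sigma> > 0"
  shows "\<exists>E. (E \<longlongrightarrow> 0) at_top \<and>
    (\<forall>T. (\<Sum>m=1..M. (cmod (b m))\<^sup>2 * real m powr (-2 * \<sigma>))
        \<le> (LINT t|cauchy_law T. (cmod (g (Complex \<sigma> t)))\<^sup>2) + E T)"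
proof -
  define e where "e m t = (of_nat m :: complex) powr (- Complex \<sigma> t)" for m t
  define G where "G t = g (Complex \<sigma> t)" for t
  define P where "P t = (\<Sum>k=1..M. b k * e k t)" for t
  define S where "S = (\<Sum>m=1..M. (cmod (b m))\<^sup>2 * real m powr (-2 * \<sigma>))"
  have cont_e: "continuous_on UNIV (\<lambda>t. e m t)" for m
    unfolding e_def by (rule continuous_on_vertical_line[OF _ \<sigma>]) (intro holomorphic_intros)
  have cont_G: "continuous_on UNIV G"
    unfolding G_def by (rule continuous_on_vertical_line[OF hol \<sigma>])
  have norm_e: "cmod (e m t) \<le> 1" for m t
    using \<sigma> powr_mono[of "- \<sigma>" 0 "real m"]
    by (cases "m = 0") (simp_all add: e_def norm_of_nat_powr)
  have norm_G: "cmod (G t) \<le> K" for t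
    unfolding G_def using \<sigma> by (intro g) (simp add: half_plane_def)
  have cont_P: "continuous_on UNIV P"
    unfolding P_def by (intro continuous_intros cont_e)
  have norm_P: "cmod (P t) \<le> (\<Sum>k=1..M. cmod (b k))" for t
    unfolding P_def using norm_e by (intro sum_norm_le) (simp add: norm_mult mult_left_le)
  have int_eH: "integrable (cauchy_law T) (\<lambda>t. H t * cnj (e m t))"
    if "continuous_on UNIV H" "\<And>t. cmod (H t) \<le> C" for H C T m
  proof (rule integrable_cauchy_law)
    show "continuous_on UNIV (\<lambda>t. H t * cnj (e m t))"
      by (intro continuous_intros that cont_e)
    show "norm (H t * cnj (e m t)) \<le> C * 1" for t
      unfolding norm_mult complex_mod_cnj using that(2)[of t] norm_e[of m t] norm_ge_zero[of "H t"]
      by (intro mult_mono order.trans[OF norm_ge_zero that(2)]) auto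
  qed
  note int_P = int_eH[OF cont_P norm_P] and int_G = int_eH[OF cont_G norm_G]
    and int_e = int_eH[OF cont_e norm_e]
  have eps: "((\<lambda>T. LINT t|cauchy_law T. P t * cnj (e m t)) \<longlongrightarrow> b m * of_real (real m powr (-2 * \<sigma>))) at_top"
    if m: "m \<in> {1..M}" for m
  proof -
    have "((\<lambda>T. \<Sum>k=1..M. b k * (LINT t|cauchy_law T. e k t * cnj (e m t)))
        \<longlongrightarrow> (\<Sum>k=1..M. b k * (if m = k then of_real (real m powr (-2 * \<sigma>)) else 0))) at_top"
      unfolding e_def using m \<sigma> by (intro tendsto_intros dirichlet_characters_orthogonal) auto
    also have "(\<Sum>k=1..M. b k * (if m = k then of_real (real m powr (-2 * \<sigma>)) else 0))
        = b m * of_real (real m powr (-2 * \<sigma>))"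
      using m by (simp add: if_distrib cong: if_cong)
    also have "(\<lambda>T. \<Sum>k=1..M. b k * (LINT t|cauchy_law T. e k t * cnj (e m t)))
        = (\<lambda>T. LINT t|cauchy_law T. P t * cnj (e m t))"
      unfolding P_def sum_distrib_right mult.assoc using int_e by (simp add: Bochner_Integration.integral_sum)
    finally show ?thesis .
  qed
  have rem: "((\<lambda>T. LINT t|cauchy_law T. (G t - P t) * cnj (e m t)) \<longlongrightarrow> 0) at_top"
    if m: "m \<in> {1..M}" for m
  proof -
    define F where "F s = of_nat m powr s * (g s - (\<Sum>k=1..M. dirichlet_term b s k))" for s
    from dirichlet_remainder(1)[OF g b \<sigma>, where m = m and M = M] m
    obtain K' where K': "\<And>s. Re s \<ge> \<sigma> \<Longrightarrow> cmod (F s) \<le> K'" unfolding F_def by auto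
    have "((\<lambda>T. LINT t|cauchy_law T. F (Complex \<sigma> t)) \<longlongrightarrow> 0) at_top"
    proof (rule integral_cauchy_law_tendsto[OF _ \<sigma> K'])
      show "F holomorphic_on half_plane 0"
        unfolding F_def dirichlet_term_def by (intro holomorphic_intros hol)
      show "((\<lambda>x. F (of_real x)) \<longlongrightarrow> 0) at_top"
        unfolding F_def by (rule dirichlet_remainder(2)[OF g b \<sigma>]) (use m in auto)
    qed
    from tendsto_mult[OF tendsto_const[of "of_real (real m powr (-2 * \<sigma>))"] this]
    have "((\<lambda>T. LINT t|cauchy_law T. of_real (real m powr (-2 * \<sigma>)) * F (Complex \<sigma> t)) \<longlongrightarrow> 0) at_top"
      by simp
    also have "(\<lambda>t. of_real (real m powr (-2 * \<sigma>)) * F (Complex \<sigma> t)) = (\<lambda>t. (G t - P t) * cnj (e m t))"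
      using m unfolding F_def G_def P_def e_def dirichlet_term_def
      by (subst cnj_dirichlet_character) (auto simp: mult_ac)
    finally show ?thesis .
  qed
  have G_lim: "((\<lambda>T. LINT t|cauchy_law T. G t * cnj (e m t)) \<longlongrightarrow> b m * of_real (real m powr (-2 * \<sigma>))) at_top"
    if m: "m \<in> {1..M}" for m
  proof -
    have "((\<lambda>T. (LINT t|cauchy_law T. P t * cnj (e m t)) + (LINT t|cauchy_law T. (G t - P t) * cnj (e m t)))
        \<longlongrightarrow> b m * of_real (real m powr (-2 * \<sigma>)) + 0) at_top"
      by (intro tendsto_add eps rem m)
    then show ?thesis using int_P int_G by (simp add: left_diff_distrib)
  qed
  have pair: "((\<lambda>T. LINT t|cauchy_law T. H t * cnj (P t)) \<longlongrightarrow> of_real S) at_top"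
    if H: "\<And>T m. integrable (cauchy_law T) (\<lambda>t. H t * cnj (e m t))"
      "\<And>m. m \<in> {1..M} \<Longrightarrow> ((\<lambda>T. LINT t|cauchy_law T. H t * cnj (e m t)) \<longlongrightarrow> b m * of_real (real m powr (-2 * \<sigma>))) at_top"
    for H
  proof -
    have "((\<lambda>T. \<Sum>m=1..M. cnj (b m) * (LINT t|cauchy_law T. H t * cnj (e m t)))
       \<longlongrightarrow> (\<Sum>m=1..M. cnj (b m) * (b m * of_real (real m powr (-2 * \<sigma>))))) at_top"
      by (intro tendsto_intros H)
    also have "(\<Sum>m=1..M. cnj (b m) * (b m * of_real (real m powr (-2 * \<sigma>)))) = of_real S"
      unfolding S_def of_real_sum of_real_mult complex_norm_square
      by (intro sum.cong) (auto simp: mult_ac)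
    also have "(\<lambda>T. \<Sum>m=1..M. cnj (b m) * (LINT t|cauchy_law T. H t * cnj (e m t)))
       = (\<lambda>T. LINT t|cauchy_law T. (\<Sum>m=1..M. cnj (b m) * (H t * cnj (e m t))))"
      using H(1) by (simp add: Bochner_Integration.integral_sum)
    also have "(\<lambda>t. \<Sum>m=1..M. cnj (b m) * (H t * cnj (e m t))) = (\<lambda>t. H t * cnj (P t))"
      by (simp add: P_def sum_distrib_left mult_ac)
    finally show ?thesis .
  qed
  define E where "E T = S - (LINT t|cauchy_law T. 2 * Re (G t * cnj (P t)) - Re (P t * cnj (P t)))" for T
  have int_pair: "integrable (cauchy_law T) (\<lambda>t. H t * cnj (P t))"
    if "continuous_on UNIV H" "\<And>t. cmod (H t) \<le> C" for H C T
  proof (rule integrable_cauchy_law)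
    show "continuous_on UNIV (\<lambda>t. H t * cnj (P t))"
      by (intro continuous_intros that cont_P)
    show "norm (H t * cnj (P t)) \<le> C * (\<Sum>k=1..M. cmod (b k))" for t
      unfolding norm_mult complex_mod_cnj using that(2)[of t] norm_P[of t] norm_ge_zero[of "H t"]
      by (intro mult_mono order.trans[OF norm_ge_zero that(2)]) auto
  qed
  note int_PP = int_pair[OF cont_P norm_P] and int_GP = int_pair[OF cont_G norm_G]
  have int_Re: "integrable (cauchy_law T) (\<lambda>t. 2 * Re (X t) - Re (Y t))"
    if "integrable (cauchy_law T) X" "integrable (cauchy_law T) Y" for T X Y
    using that by simp
  have "((\<lambda>T. S - (2 * Re (LINT t|cauchy_law T. G t * cnj (P t)) - Re (LINT t|cauchy_law T. P t * cnj (P t))))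
      \<longlongrightarrow> S - (2 * Re (of_real S) - Re (of_real S))) at_top"
    by (intro tendsto_intros pair int_P int_G eps G_lim)
  moreover have "(LINT t|cauchy_law T. 2 * Re (X t) - Re (Y t))
      = 2 * Re (LINT t|cauchy_law T. X t) - Re (LINT t|cauchy_law T. Y t)"
    if "integrable (cauchy_law T) X" "integrable (cauchy_law T) Y" for T X Y
    using that by simp
  from this[OF int_GP int_PP] have "E = (\<lambda>T. S - (2 * Re (LINT t|cauchy_law T. G t * cnj (P t))
      - Re (LINT t|cauchy_law T. P t * cnj (P t))))"
    unfolding E_def by (intro ext) simp
  ultimately have "(E \<longlongrightarrow> 0) at_top" by simp
  moreover have "S \<le> (LINT t|cauchy_law T. (cmod (g (Complex \<sigma> t)))\<^sup>2) + E T" for T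
  proof -
    have "2 * Re (G t * cnj (P t)) - Re (P t * cnj (P t)) \<le> (cmod (G t))\<^sup>2" for t
    proof -
      have "0 \<le> (cmod (G t - P t))\<^sup>2" by simp
      then show ?thesis unfolding cmod_power2 by (simp add: power2_eq_square algebra_simps)
    qed
    moreover have "integrable (cauchy_law T) (\<lambda>t. (cmod (G t))\<^sup>2)"
      using norm_G by (intro integrable_cauchy_law[where K = "K\<^sup>2"] continuous_intros cont_G)
        (auto intro!: power_mono)
    ultimately have "(LINT t|cauchy_law T. 2 * Re (G t * cnj (P t)) - Re (P t * cnj (P t)))
        \<le> (LINT t|cauchy_law T. (cmod (G t))\<^sup>2)"
      using int_Re[OF int_GP int_PP] by (intro integral_mono) auto
    then show ?thesis unfolding E_def G_def by linarith
  qed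
  ultimately show ?thesis unfolding S_def by blast
qed

section \<open>Dirichlet series with square-summable coefficients\<close>

lemma summable_l2_dirichlet_bound:
  assumes "summable (\<lambda>n. (cmod (a n))\<^sup>2)" "x > 1 / 2"
  shows "summable (\<lambda>n. (cmod (a n))\<^sup>2 + real n powr (-2 * x))"
  using assms by (intro summable_add) (auto simp: summable_real_powr_iff)

lemma norm_dirichlet_term_le:
  assumes "Re s \<ge> x"
  shows "cmod (dirichlet_term a s n) \<le> (cmod (a n))\<^sup>2 + real n powr (-2 * x)"
proof -
  have "cmod (dirichlet_term a s n) \<le> cmod (a n) * real n powr (- x)"
    unfolding norm_dirichlet_term using assms
    by (cases "n = 0") (auto intro!: mult_left_mono powr_mono)
  also have "\<dots> \<le> (cmod (a n))\<^sup>2 + (real n powr (- x))\<^sup>2"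
    using sum_squares_bound[of "cmod (a n)" "real n powr (- x)"]
      mult_nonneg_nonneg[of "cmod (a n)" "real n powr (- x)", OF norm_ge_zero powr_ge_zero] by linarith
  also have "(real n powr (- x))\<^sup>2 = real n powr (-2 * x)"
    by (simp add: power2_eq_square flip: powr_add)
  finally show ?thesis .
qed

lemma l2_dirichlet_has_sum:
  assumes "summable (\<lambda>n. (cmod (a n))\<^sup>2)" "Re s > 1 / 2"
  shows "(dirichlet_term a s has_sum dirichlet_series a s) UNIV"
proof -
  have "summable (\<lambda>n. norm (dirichlet_term a s n))"
    by (rule summable_comparison_test'[OF summable_l2_dirichlet_bound[OF assms], of 0])
       (use norm_dirichlet_term_le[OF order_refl] in auto)
  then show ?thesis unfolding dirichlet_series_def
    by (intro norm_summable_imp_has_sum summable_sums) (auto dest: summable_norm_cancel)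
qed

lemma l2_dirichlet_holomorphic:
  assumes "summable (\<lambda>n. (cmod (a n))\<^sup>2)"
  shows "dirichlet_series a holomorphic_on half_plane (1 / 2)"
proof (rule holomorphic_uniform_sequence[OF open_half_plane])
  show "(\<lambda>s. \<Sum>n<N. dirichlet_term a s n) holomorphic_on half_plane (1 / 2)" for N
    unfolding dirichlet_term_def by (intro holomorphic_intros)
  fix z assume "z \<in> half_plane (1 / 2)"
  then have z: "Re z > 1 / 2" by (simp add: half_plane_def)
  define r where "r = (Re z - 1 / 2) / 2"
  have Re_ge: "Re s \<ge> 1 / 2 + r" if "s \<in> cball z r" for s
    using that abs_Re_le_cmod[of "z - s"] unfolding r_def dist_norm mem_cball
    by (simp add: field_simps)
  have "uniform_limit (cball z r) (\<lambda>N s. \<Sum>n<N. dirichlet_term a s n) (\<lambda>s. \<Sum>n. dirichlet_term a s n) sequentially"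
  proof (rule Weierstrass_m_test)
    show "summable (\<lambda>n. (cmod (a n))\<^sup>2 + real n powr (-2 * (1 / 2 + r)))"
      by (rule summable_l2_dirichlet_bound[OF assms]) (use z in \<open>simp add: r_def\<close>)
  qed (use norm_dirichlet_term_le[OF Re_ge] in blast)
  moreover have "cball z r \<subseteq> half_plane (1 / 2)"
  proof
    fix s assume "s \<in> cball z r"
    from Re_ge[OF this] z show "s \<in> half_plane (1 / 2)"
      by (simp add: half_plane_def r_def field_simps)
  qed
  ultimately show "\<exists>d>0. cball z d \<subseteq> half_plane (1 / 2) \<and>
      uniform_limit (cball z d) (\<lambda>N s. \<Sum>n<N. dirichlet_term a s n) (dirichlet_series a) sequentially"
    using z unfolding dirichlet_series_def[abs_def] by (intro exI[of _ r]) (auto simp: r_def)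
qed

text \<open>
  Uniqueness of coefficients is Bessel's inequality for the zero function.
\<close>

lemma dirichlet_coefficients_zero:
  assumes "\<And>s. Re s \<ge> \<theta> \<Longrightarrow> (dirichlet_term b s has_sum 0) UNIV" "m \<ge> 1"
  shows "b m = 0"
proof -
  obtain E where E: "(E \<longlongrightarrow> 0) at_top"
    "\<And>T. (\<Sum>k=1..m. (cmod (b k))\<^sup>2 * real k powr (-2 * 1))
      \<le> (LINT t|cauchy_law T. (cmod (0 :: complex))\<^sup>2) + E T"
    using bessel_inequality_dirichlet[of "\<lambda>_. 0" 0 \<theta> b 1 m] assms(1) by auto
  have "(\<Sum>k=1..m. (cmod (b k))\<^sup>2 * real k powr (-2 * 1)) \<le> 0"
    by (rule tendsto_lowerbound[OF E(1)]) (use E(2) in auto)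
  moreover have "(cmod (b m))\<^sup>2 * real m powr (-2 * 1) \<le> (\<Sum>k=1..m. (cmod (b k))\<^sup>2 * real k powr (-2 * 1))"
    using assms(2) by (intro member_le_sum) auto
  ultimately have "(cmod (b m))\<^sup>2 * real m powr (-2 * 1) \<le> 0" by linarith
  then show ?thesis using assms(2) by (simp add: mult_le_0_iff)
qed

lemma h2_fun_has_sum:
  "Re s > 1 / 2 \<Longrightarrow> (dirichlet_term (h2_coeff f) s has_sum h2_fun f s) UNIV"
  unfolding h2_fun_def by (rule l2_dirichlet_has_sum[OF summable_h2_coeff])

lemma h2_fun_inject:
  assumes "\<And>s. s \<in> half_plane (1 / 2) \<Longrightarrow> h2_fun f s = h2_fun g s"
  shows "f = g"
proof (rule h2_eqI)
  fix n
  have "h2_coeff f n - h2_coeff g n = 0" if "n \<ge> 1"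
  proof (rule dirichlet_coefficients_zero[OF _ that])
    fix s :: complex assume "Re s \<ge> 1"
    then have "((\<lambda>n. dirichlet_term (h2_coeff f) s n + - dirichlet_term (h2_coeff g) s n) has_sum h2_fun f s + - h2_fun g s) UNIV"
      by (intro has_sum_add has_sum_uminusI h2_fun_has_sum) auto
    also have "(\<lambda>n. dirichlet_term (h2_coeff f) s n + - dirichlet_term (h2_coeff g) s n)
        = dirichlet_term (\<lambda>n. h2_coeff f n - h2_coeff g n) s"
      by (simp add: fun_eq_iff dirichlet_term_def algebra_simps)
    finally show "(dirichlet_term (\<lambda>n. h2_coeff f n - h2_coeff g n) s has_sum 0) UNIV"
      using assms[of s] \<open>Re s \<ge> 1\<close> by (simp add: half_plane_def)
  qed
  then show "h2_coeff f n = h2_coeff g n" by (cases "n = 0") auto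
qed

section \<open>Powers with the symbol as exponent\<close>

text \<open>
  The powers are exponentials of multiples of the Dirichlet series of \<open>\<phi>\<close>. The row \<open>b n\<close> contains the
  coefficients of the image of \<open>n powr (- s)\<close> under the composition operator; row and column \<open>0\<close> are
  set to zero, in line with the coefficients of elements of \<^typ>\<open>h2\<close>.
\<close>

lemma symbol_powers_dirichlet:
  assumes "\<phi> \<in> symbol_class_G0"
  shows "\<exists>\<theta> b. \<theta> > 0 \<and> (\<forall>m. b 0 m = 0) \<and> (\<forall>n. b n 0 = 0) \<and>
    (\<forall>n s. Re s \<ge> \<theta> \<longrightarrow> (dirichlet_term (b n) s has_sum of_nat n powr (- \<phi> s)) UNIV)"
proof -
  from assms obtain c s0 where c: "summable (dirichlet_term c s0)"
    and \<phi>: "\<And>s. s \<in> half_plane 0 \<Longrightarrow> summable (dirichlet_term c s) \<Longrightarrow> \<phi> s = dirichlet_series c s"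
    unfolding symbol_class_G0_def by blast
  \<comment> \<open>The maximum keeps the half-plane inside \<open>half_plane 0\<close>, where \<open>\<phi>\<close> is given by its series.\<close>
  define \<theta> where "\<theta> = max 1 (Re s0 + 2)"
  have series: "(dirichlet_term c s has_sum \<phi> s) UNIV" if s: "Re s \<ge> \<theta>" for s
  proof -
    have *: "(dirichlet_term c s has_sum dirichlet_series c s) UNIV"
      by (rule dirichlet_abs_convergent[OF c]) (use s in \<open>simp add: \<theta>_def\<close>)
    then have "summable (dirichlet_term c s)"
      by (intro summable_on_imp_summable has_sum_imp_summable)
    then have "\<phi> s = dirichlet_series c s"
      using s by (intro \<phi>) (auto simp: half_plane_def \<theta>_def)
    with * show ?thesis by simp
  qed
  have "\<exists>b. b 0 = 0 \<and> (\<forall>s. Re s \<ge> \<theta> \<longrightarrow> (dirichlet_term b s has_sum of_nat n powr (- \<phi> s)) UNIV)"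
    if "n \<noteq> 0" for n
  proof -
    have "(dirichlet_term (\<lambda>k. - ln (real n) * c k) s has_sum - ln (real n) * \<phi> s) UNIV" if "Re s \<ge> \<theta>" for s
      using has_sum_cmult_right[OF series[OF that], of "- ln (real n)"]
      by (simp add: dirichlet_term_def[abs_def] mult.assoc)
    from dirichlet_series_exp[OF this]
    have "\<exists>b. b 0 = 0 \<and> (\<forall>s. Re s \<ge> \<theta> \<longrightarrow>
        (dirichlet_term b s has_sum exp (- ln (real n) * \<phi> s)) UNIV)" .
    moreover have "exp (- ln (real n) * \<phi> s) = of_nat n powr (- \<phi> s)" for s
      using that by (simp add: powr_def Ln_of_nat mult.commute)
    ultimately show ?thesis by simp
  qed
  then obtain b where b: "\<And>n. n \<noteq> 0 \<Longrightarrow> b n 0 = 0 \<and>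
      (\<forall>s. Re s \<ge> \<theta> \<longrightarrow> (dirichlet_term (b n) s has_sum of_nat n powr (- \<phi> s)) UNIV)" by metis
  define b' where "b' n = (if n = 0 then (\<lambda>_. 0) else b n)" for n
  have "b' n 0 = 0" "b' 0 m = 0" for n m using b by (auto simp: b'_def)
  moreover have "(dirichlet_term (b' n) s has_sum of_nat n powr (- \<phi> s)) UNIV" if "Re s \<ge> \<theta>" for n s
    using b[of n] that by (auto simp: b'_def dirichlet_term_def[abs_def])
  moreover have "\<theta> > 0" by (simp add: \<theta>_def)
  ultimately show ?thesis by blast
qed

lemma symbol_power_bound:
  assumes "\<phi> \<in> symbol_class_G0" "s \<in> half_plane 0"
  shows "cmod (of_nat n powr (- \<phi> s)) \<le> real n powr (- 1 / 2)"
proof -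
  have "Re (\<phi> s) > 1 / 2"
    using assms by (auto simp: symbol_class_G0_def half_plane_def)
  then show ?thesis unfolding norm_of_nat_powr
    by (cases "n = 0") (auto intro!: powr_mono)
qed

text \<open>
  The value of \<open>\<phi>\<close> at \<open>+\<infinity>\<close> lies in the open half-plane. Consider \<open>g s = 2 powr (- \<phi> s)\<close>, which has modulus
  below \<open>2 powr (- 1 / 2)\<close>, and its constant coefficient \<open>b 1 = g (+\<infinity>)\<close>. If \<open>b 1\<close> had the extreme modulus,
  Bessel's inequality would leave no room for any other coefficient, and \<open>g\<close> would be the constant
  \<open>b 1\<close>, whose modulus is too large. Thus \<open>\<bar>g\<bar>\<close> stays away from the extreme value near \<open>+\<infinity>\<close>.
\<close>

lemma symbol_limit_interior:
  assumes \<phi>: "\<phi> \<in> symbol_class_G0"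
  obtains \<kappa> where "\<kappa> > 1 / 2" "\<forall>\<^sub>F x in at_top. Re (\<phi> (of_real x)) \<ge> \<kappa>"
proof -
  define g where "g s = of_nat 2 powr (- \<phi> s)" for s
  from symbol_powers_dirichlet[OF \<phi>] obtain \<theta> b' where \<theta>: "\<theta> > 0"
    and b': "\<And>n s. Re s \<ge> \<theta> \<Longrightarrow> (dirichlet_term (b' n) s has_sum of_nat n powr (- \<phi> s)) UNIV"
    by blast
  define b where "b = b' 2"
  have b: "(dirichlet_term b s has_sum g s) UNIV" if "Re s \<ge> \<theta>" for s
    unfolding b_def g_def by (rule b'[OF that])
  have Re_\<phi>: "Re (\<phi> s) > 1 / 2" if "Re s > 0" for s
    using \<phi> that by (auto simp: symbol_class_G0_def half_plane_def)
  have "\<phi> holomorphic_on half_plane 0" using \<phi> by (simp add: symbol_class_G0_def)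
  then have hol: "g holomorphic_on half_plane 0" unfolding g_def by (intro holomorphic_intros)
  have norm_g: "cmod (g s) = 2 powr (- Re (\<phi> s))" for s
    unfolding g_def norm_of_nat_powr by simp
  have g_less: "cmod (g s) < 2 powr (- 1 / 2)" if "Re s > 0" for s
    unfolding norm_g using Re_\<phi>[OF that] by simp
  have g_le: "cmod (g s) \<le> 2 powr (- 1 / 2)" if "s \<in> half_plane 0" for s
    using g_less[of s] that by (simp add: half_plane_def)
  note limit = dirichlet_coefficient_limit[OF g_le b]
  have sq: "(2 powr (- 1 / 2))\<^sup>2 = (1 / 2 :: real)"
    by (simp only: power2_eq_square powr_add[symmetric]) (simp add: powr_minus)
  have parseval: "(\<Sum>m=1..M. (cmod (b m))\<^sup>2 * real m powr (-2 * 1)) \<le> 1 / 2" for M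
  proof -
    obtain E where E: "(E \<longlongrightarrow> 0) at_top"
      "\<And>T. (\<Sum>m=1..M. (cmod (b m))\<^sup>2 * real m powr (-2 * 1))
        \<le> (LINT t|cauchy_law T. (cmod (g (Complex 1 t)))\<^sup>2) + E T"
      using bessel_inequality_dirichlet[OF hol g_le b zero_less_one, where M = M] by blast
    have "(cmod (g (Complex 1 t)))\<^sup>2 \<le> 1 / 2" for t
      using power_mono[OF g_le[of "Complex 1 t"], of 2] unfolding sq by (simp add: half_plane_def)
    then have "(LINT t|cauchy_law T. (cmod (g (Complex 1 t)))\<^sup>2) \<le> (LINT t|cauchy_law T. 1 / 2)" for T
      using continuous_on_vertical_line[OF hol zero_less_one]
      by (intro integral_mono integrable_cauchy_law[where K = "1 / 2"] continuous_intros) auto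
    then have "(LINT t|cauchy_law T. (cmod (g (Complex 1 t)))\<^sup>2) \<le> 1 / 2" for T by simp
    then have "(\<Sum>m=1..M. (cmod (b m))\<^sup>2 * real m powr (-2 * 1)) - 1 / 2 \<le> E T" for T
      using E(2)[of T] by (smt (verit, best))
    then have "(\<Sum>m=1..M. (cmod (b m))\<^sup>2 * real m powr (-2 * 1)) - 1 / 2 \<le> 0"
      by (intro tendsto_lowerbound[OF E(1)]) auto
    then show ?thesis by simp
  qed
  have b1: "cmod (b 1) < 2 powr (- 1 / 2)"
  proof (rule ccontr)
    assume "\<not> cmod (b 1) < 2 powr (- 1 / 2)"
    then have "(cmod (b 1))\<^sup>2 \<ge> 1 / 2"
      using power_mono[of "2 powr (- 1 / 2)" "cmod (b 1)" 2] unfolding sq by simp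
    have "b m = 0" if "m > 1" for m
    proof -
      have "(\<Sum>k\<in>{1, m}. (cmod (b k))\<^sup>2 * real k powr (-2 * 1))
          \<le> (\<Sum>k=1..m. (cmod (b k))\<^sup>2 * real k powr (-2 * 1))"
        using that by (intro sum_mono2) auto
      then have "(cmod (b 1))\<^sup>2 + (cmod (b m))\<^sup>2 * real m powr (-2 * 1) \<le> 1 / 2"
        using parseval[of m] that by simp
      then have "(cmod (b m))\<^sup>2 * real m powr (-2 * 1) \<le> 0"
        using \<open>(cmod (b 1))\<^sup>2 \<ge> 1 / 2\<close> by linarith
      then show ?thesis using that by (simp add: mult_le_0_iff)
    qed
    then have "dirichlet_term b (of_real \<theta>) m = 0" if "m \<noteq> 1" for m
      using that by (cases "m = 0") (auto simp: dirichlet_term_def)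
    then have "(dirichlet_term b (of_real \<theta>) has_sum b 1) UNIV"
      by (intro has_sum_finite_neutralI[of "{1}"]) (auto simp: dirichlet_term_def)
    then have "g (of_real \<theta>) = b 1"
      using has_sum_unique b[of "of_real \<theta>"] by (metis Re_complex_of_real order_refl)
    then show False using g_less[of "of_real \<theta>"] \<theta> \<open>\<not> cmod (b 1) < 2 powr (- 1 / 2)\<close> by simp
  qed
  \<comment> \<open>Near \<open>+\<infinity>\<close> one has \<open>2 powr (- Re \<phi>) = \<bar>g\<bar> < q\<close>, that is, \<open>Re \<phi> > - log 2 q\<close>.\<close>
  obtain q where q: "cmod (b 1) < q" "q < 2 powr (- 1 / 2)" using dense[OF b1] by blast
  then have "q > 0" by (smt (verit) norm_ge_zero)
  have "2 powr (log 2 q) < 2 powr (- 1 / 2 :: real)" using q \<open>q > 0\<close> by simp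
  then have \<kappa>: "- log 2 q > 1 / 2" by simp
  have "\<forall>\<^sub>F x in at_top. cmod (g (of_real x)) < q"
    using order_tendstoD(2)[OF tendsto_norm[OF limit] q(1)] .
  then have "\<forall>\<^sub>F x in at_top. Re (\<phi> (of_real x)) \<ge> - log 2 q"
  proof (rule eventually_mono)
    fix x assume "cmod (g (of_real x)) < q"
    also have "q = 2 powr (log 2 q)" using \<open>q > 0\<close> by simp
    finally show "Re (\<phi> (of_real x)) \<ge> - log 2 q" unfolding norm_g by simp
  qed
  then show ?thesis using that \<kappa> by blast
qed

section \<open>The Hilbert--Schmidt bound\<close>

text \<open>
  An elementary upper bound for the partial sums of \<open>\<zeta> (1 + y)\<close>: the tail is dominated by the telescoping sum of
  \<open>((n - 1) powr (- y) - n powr (- y)) / y\<close>, by \<open>ln (1 - 1 / n) \<le> - 1 / n\<close> and \<open>1 + x \<le> exp x\<close>.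
\<close>

lemma sum_powr_le:
  assumes y: "y > (0::real)"
  shows "(\<Sum>n=1..N. real n powr (-1 - y)) \<le> 1 + 1 / y"
proof -
  have "(\<Sum>n=1..N. real n powr (-1 - y)) \<le> 1 + (1 - real N powr (- y)) / y" if "N \<ge> 1" for N
    using that
  proof (induction N rule: dec_induct)
    case base
    then show ?case by simp
  next
    case (step N)
    define n where "n = real (Suc N)"
    have n: "n \<ge> 2" "real N = n - 1" using step by (auto simp: n_def)
    have "ln (n - 1) = ln (n * (1 - 1 / n))"
      using n by (simp add: right_diff_distrib)
    also have "\<dots> = ln n + ln (1 - 1 / n)"
      using n by (intro ln_mult_pos) auto
    also have "\<dots> \<le> ln n + (- 1 / n)"
      using n ln_le_minus_one[of "1 - 1 / n"] by simp
    finally have "- y * ln n + y / n \<le> - y * ln (n - 1)"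
      using mult_left_mono[of "ln (n - 1)" "ln n + (- 1 / n)" y] y by (simp add: algebra_simps)
    then have "exp (- y * ln n + y / n) \<le> (n - 1) powr (- y)"
      using n by (simp add: powr_def)
    moreover have "n powr (- y) * (1 + y / n) \<le> n powr (- y) * exp (y / n)"
      by (intro mult_left_mono exp_ge_add_one_self) auto
    moreover have "n powr (- y) * exp (y / n) = exp (- y * ln n + y / n)"
      using n exp_add[of "- y * ln n" "y / n"] by (simp add: powr_def)
    ultimately have "n powr (- y) * (1 + y / n) \<le> (n - 1) powr (- y)" by linarith
    then have "y * (n powr (- y) / n) \<le> (n - 1) powr (- y) - n powr (- y)"
      by (simp add: field_simps)
    moreover have "n powr (- 1 - y) = n powr (- y) / n"
    proof -
      have "- 1 - y = - y - 1" by simp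
      then have "n powr (- 1 - y) = n powr (- y) / n powr 1" by (simp only: powr_diff)
      then show ?thesis using n by simp
    qed
    ultimately have "n powr (- 1 - y) \<le> ((n - 1) powr (- y) - n powr (- y)) / y"
      using y by (simp add: field_simps)
    moreover have "(\<Sum>n=1..Suc N. real n powr (-1 - y)) = (\<Sum>n=1..N. real n powr (-1 - y)) + n powr (- 1 - y)"
      by (simp add: n_def)
    ultimately show ?case using step.IH n
      by (simp add: n_def[symmetric] diff_divide_distrib)
  qed
  moreover have "(1 - real N powr (- y)) / y \<le> 1 / y"
    using y by (intro divide_right_mono) auto
  ultimately show ?thesis using y by (cases "N \<ge> 1") (force simp: not_le)+
qed

text \<open>
  In a sector of half-angle \<open>\<alpha> < \<pi> / 2\<close> the modulus is at most the real part divided by \<open>cos \<alpha>\<close>, so the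
  reciprocal of the real part is dominated by a positive harmonic function. The shift \<open>\<eta>\<close> keeps the point
  inside the sector and makes that function bounded on the whole half-plane.
\<close>

lemma sector_Re_inverse:
  assumes z: "z \<in> angular_sector w \<alpha>" and \<alpha>: "0 < \<alpha>" "\<alpha> < pi / 2" and \<eta>: "\<eta> > 0"
  shows "1 / (Re z - Re w + \<eta>) \<le> Re (1 / (z - w + of_real \<eta>)) / (cos \<alpha>)\<^sup>2"
proof -
  define u where "u = z - w"
  define y where "y = u + of_real \<eta>"
  have u: "u \<noteq> 0" "\<bar>Arg u\<bar> < \<alpha>" using z by (auto simp: angular_sector_def u_def)
  have c: "cos \<alpha> > 0" using \<alpha> by (intro cos_gt_zero) auto
  have "cos \<alpha> \<le> cos \<bar>Arg u\<bar>"
    using u \<alpha> by (intro cos_monotone_0_pi_le) auto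
  then have "cmod u * cos \<alpha> \<le> cmod u * cos (Arg u)"
    by (intro mult_left_mono) auto
  also have "cmod u * cos (Arg u) = Re u"
    using rcis_cmod_Arg[of u] by (metis Re_rcis)
  finally have Re_u: "cmod u * cos \<alpha> \<le> Re u" .
  have "cmod y * cos \<alpha> \<le> (cmod u + \<eta>) * cos \<alpha>"
    using c \<eta> norm_triangle_ineq[of u "of_real \<eta>"] by (intro mult_right_mono) (auto simp: y_def)
  also have "\<dots> \<le> cmod u * cos \<alpha> + \<eta> * 1"
    using \<eta> by (simp add: distrib_right)
  also have "\<dots> \<le> Re y" using Re_u by (simp add: y_def)
  finally have le: "cmod y * cos \<alpha> \<le> Re y" .
  have pos: "Re y > 0"
  proof -
    have "0 \<le> cmod u * cos \<alpha>" using c by simp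
    then show ?thesis using Re_u \<eta> by (simp add: y_def)
  qed
  then have "cmod y > 0" by auto
  have "(cmod y * cos \<alpha>)\<^sup>2 \<le> (Re y)\<^sup>2" using le c by (intro power_mono) auto
  then have "1 / Re y \<le> (Re y / (cmod y)\<^sup>2) / (cos \<alpha>)\<^sup>2"
    using pos \<open>cmod y > 0\<close> c by (simp add: field_simps power2_eq_square)
  also have "Re y / (cmod y)\<^sup>2 = Re (1 / y)"
    by (simp add: Re_divide cmod_power2)
  finally show ?thesis by (simp add: y_def u_def)
qed

text \<open>
  Bessel's inequality for the functions \<open>n powr (- \<phi> s)\<close> with \<open>n \<le> N\<close>, added up, bounds the sum of squares
  by means of \<open>\<Sum>n\<le>N. n powr (- 2 Re (\<phi> s))\<close>. That sum is at most \<open>1 + 1 / (2 Re (\<phi> s) - 1)\<close>, hence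
  controlled by \<open>1 / \<delta>\<close> where \<open>\<phi> s\<close> is away from the critical line and by the harmonic functions
  \<open>Re (1 / (\<phi> s - w))\<close> where it lies in a sector with vertex \<open>w\<close>. The means of the latter equal their values at
  \<open>\<sigma> + T\<close>, which stay bounded because \<open>\<phi>\<close> has its limit at \<open>+\<infinity>\<close> inside the half-plane. The factor
  \<open>(N + 1) powr (2 \<eta>)\<close>, which pays for the shift of the harmonic functions by \<open>\<eta>\<close>, tends to \<open>1\<close> with
  \<open>\<eta>\<close>; the remaining bound is independent of \<open>N\<close>, \<open>M\<close> and \<open>\<sigma>\<close>.
\<close>

proposition symbol_hilbert_schmidt:
  fixes \<alpha> \<tau> :: "nat \<Rightarrow> real"
  assumes \<phi>: "\<phi> \<in> symbol_class_G0" and \<delta>: "\<delta> > 0"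
    and \<alpha>: "\<And>j. j \<in> {1..d} \<Longrightarrow> 0 < \<alpha> j \<and> \<alpha> j < pi / 2"
    and sectors: "\<phi> ` half_plane 0 \<inter> {s. 1 / 2 < Re s \<and> Re s \<le> 1 / 2 + \<delta>}
           \<subseteq> (\<Union>j\<in>{1..d}. angular_sector (Complex (1 / 2) (\<tau> j)) (\<alpha> j))"
    and b: "\<And>n s. Re s \<ge> \<theta> \<Longrightarrow> (dirichlet_term (b n) s has_sum of_nat n powr (- \<phi> s)) UNIV"
  shows "\<exists>C. \<forall>N M. (\<Sum>n=1..N. \<Sum>m=1..M. (cmod (b n m))\<^sup>2) \<le> C"
proof -
  have hol: "\<phi> holomorphic_on half_plane 0" using \<phi> by (simp add: symbol_class_G0_def)
  have Re_\<phi>: "Re (\<phi> s) > 1 / 2" if "Re s > 0" for s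
    using \<phi> that by (auto simp: symbol_class_G0_def half_plane_def)
  obtain \<kappa> where \<kappa>: "\<kappa> > 1 / 2" "\<forall>\<^sub>F x in at_top. Re (\<phi> (of_real x)) \<ge> \<kappa>"
    using symbol_limit_interior[OF \<phi>] by blast
  define w where "w j = Complex (1 / 2) (\<tau> j)" for j
  have c: "cos (\<alpha> j) > 0" if "j \<in> {1..d}" for j
    using \<alpha>[OF that] by (intro cos_gt_zero) auto
  define C where "C = 1 + 1 / (2 * \<delta>) + (\<Sum>j=1..d. 1 / (\<kappa> - 1 / 2) / (2 * (cos (\<alpha> j))\<^sup>2))"
  have bound: "(\<Sum>n=1..N. \<Sum>m=1..M. (cmod (b n m))\<^sup>2 * real m powr (-2 * \<sigma>)) \<le> real (N + 1) powr (2 * \<eta>) * C"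
    if \<sigma>: "\<sigma> > 0" and \<eta>: "\<eta> > 0" for N M \<sigma> \<eta>
  proof -
    define g where "g n s = of_nat n powr (- \<phi> s)" for n :: nat and s
    have hol_g: "g n holomorphic_on half_plane 0" for n
      unfolding g_def by (intro holomorphic_intros hol)
    have "\<exists>E. (E \<longlongrightarrow> 0) at_top \<and> (\<forall>T. (\<Sum>m=1..M. (cmod (b n m))\<^sup>2 * real m powr (-2 * \<sigma>))
        \<le> (LINT t|cauchy_law T. (cmod (g n (Complex \<sigma> t)))\<^sup>2) + E T)" for n
      by (rule bessel_inequality_dirichlet[OF hol_g _ _ \<sigma>])
         (unfold g_def, erule symbol_power_bound[OF \<phi>], erule b)
    then have "\<forall>n. \<exists>E. (E \<longlongrightarrow> 0) at_top \<and> (\<forall>T. (\<Sum>m=1..M. (cmod (b n m))\<^sup>2 * real m powr (-2 * \<sigma>))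
        \<le> (LINT t|cauchy_law T. (cmod (g n (Complex \<sigma> t)))\<^sup>2) + E T)" by blast
    from choice[OF this] obtain E where E: "\<And>n. (E n \<longlongrightarrow> 0) at_top"
      "\<And>n T. (\<Sum>m=1..M. (cmod (b n m))\<^sup>2 * real m powr (-2 * \<sigma>))
        \<le> (LINT t|cauchy_law T. (cmod (g n (Complex \<sigma> t)))\<^sup>2) + E n T" by blast
    \<comment> \<open>The harmonic majorants, shifted by \<open>\<eta>\<close> so that they are bounded.\<close>
    define h where "h j s = 1 / (\<phi> s - w j + of_real \<eta>)" for j s
    define U where "U s = real (N + 1) powr (2 * \<eta>) *
      (1 + 1 / (2 * \<delta>) + (\<Sum>j=1..d. Re (h j s) / (2 * (cos (\<alpha> j))\<^sup>2)))" for s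
    have Re_den: "Re (\<phi> s - w j + of_real \<eta>) > \<eta>" if "Re s > 0" for s j
      using Re_\<phi>[OF that] by (simp add: w_def)
    have hol_h: "h j holomorphic_on half_plane 0" for j
      unfolding h_def
    proof (intro holomorphic_intros hol)
      fix s assume "s \<in> half_plane 0"
      then show "\<phi> s - w j + of_real \<eta> \<noteq> 0"
        using Re_den[of s j] \<eta> unfolding half_plane_def
        by (metis mem_Collect_eq order.strict_trans order_less_irrefl zero_complex.sel(1))
    qed
    have norm_h: "cmod (h j s) \<le> 1 / Re (\<phi> s - w j + of_real \<eta>)" if "Re s > 0" for s j
      unfolding h_def norm_divide norm_one
      using Re_den[OF that, of j] \<eta> complex_Re_le_cmod[of "\<phi> s - w j + of_real \<eta>"]
      by (intro divide_left_mono mult_pos_pos) auto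
    have norm_h': "cmod (h j s) \<le> 1 / \<eta>" if "Re s > 0" for s j
      using norm_h[OF that, of j] Re_den[OF that, of j] \<eta>
      by (intro order.trans[OF norm_h[OF that, of j]] divide_left_mono mult_pos_pos) auto
    have Re_h: "Re (h j s) \<ge> 0" if "Re s > 0" for s j
      using Re_den[OF that, of j] \<eta> unfolding h_def by (simp add: Re_divide)
    have pointwise: "(\<Sum>n=1..N. (cmod (g n s))\<^sup>2) \<le> U s" if s: "Re s > 0" for s
    proof -
      define y where "y = Re (\<phi> s) - 1 / 2 + \<eta>"
      have y: "y > 0" using Re_\<phi>[OF s] \<eta> by (simp add: y_def)
      have "1 / y \<le> 1 / \<delta> + (\<Sum>j=1..d. Re (h j s) / (cos (\<alpha> j))\<^sup>2)"
      proof (cases "Re (\<phi> s) \<le> 1 / 2 + \<delta>")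
        case True
        then have "\<phi> s \<in> \<phi> ` half_plane 0 \<inter> {s. 1 / 2 < Re s \<and> Re s \<le> 1 / 2 + \<delta>}"
          using s Re_\<phi>[OF s] by (auto simp: half_plane_def)
        then obtain j where j: "j \<in> {1..d}" "\<phi> s \<in> angular_sector (w j) (\<alpha> j)"
          using sectors unfolding w_def by blast
        have "1 / y \<le> Re (h j s) / (cos (\<alpha> j))\<^sup>2"
          using sector_Re_inverse[OF j(2) _ _ \<eta>] \<alpha>[OF j(1)] by (simp add: y_def h_def w_def)
        also have "\<dots> \<le> (\<Sum>j=1..d. Re (h j s) / (cos (\<alpha> j))\<^sup>2)"
          using j(1) Re_h[OF s] by (intro member_le_sum) auto
        finally show ?thesis using \<delta> by (simp add: add_increasing)
      next
        case False
        then have "1 / y \<le> 1 / \<delta>"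
          using \<delta> \<eta> y by (intro divide_left_mono) (auto simp: y_def)
        moreover have "0 \<le> (\<Sum>j=1..d. Re (h j s) / (cos (\<alpha> j))\<^sup>2)"
          using Re_h[OF s] by (intro sum_nonneg) auto
        ultimately show ?thesis by simp
      qed
      then have "1 / y / 2 \<le> (1 / \<delta> + (\<Sum>j=1..d. Re (h j s) / (cos (\<alpha> j))\<^sup>2)) / 2"
        by (rule divide_right_mono) simp
      then have le: "1 / (2 * y) \<le> 1 / (2 * \<delta>) + (\<Sum>j=1..d. Re (h j s) / (2 * (cos (\<alpha> j))\<^sup>2))"
        by (simp add: add_divide_distrib sum_divide_distrib mult.commute)
      have "(cmod (g n s))\<^sup>2 \<le> real (N + 1) powr (2 * \<eta>) * real n powr (- 1 - 2 * y)"
        if n: "n \<in> {1..N}" for n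
      proof -
        have "(cmod (g n s))\<^sup>2 = real n powr (2 * \<eta>) * real n powr (- 1 - 2 * y)"
          unfolding g_def norm_of_nat_powr power2_eq_square powr_add[symmetric]
          by (simp add: y_def field_simps)
        also have "\<dots> \<le> real (N + 1) powr (2 * \<eta>) * real n powr (- 1 - 2 * y)"
          using n \<eta> by (intro mult_right_mono powr_mono2) auto
        finally show ?thesis .
      qed
      then have "(\<Sum>n=1..N. (cmod (g n s))\<^sup>2) \<le> (\<Sum>n=1..N. real (N + 1) powr (2 * \<eta>) * real n powr (- 1 - 2 * y))"
        by (rule sum_mono)
      also have "\<dots> = real (N + 1) powr (2 * \<eta>) * (\<Sum>n=1..N. real n powr (- 1 - 2 * y))"
        by (rule sum_distrib_left[symmetric])
      also have "\<dots> \<le> real (N + 1) powr (2 * \<eta>) * (1 + 1 / (2 * y))"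
        using y by (intro mult_left_mono sum_powr_le) auto
      also have "\<dots> \<le> U s" unfolding U_def using le by (intro mult_left_mono) auto
      finally show ?thesis .
    qed
    have int_g: "integrable (cauchy_law T) (\<lambda>t. (cmod (g n (Complex \<sigma> t)))\<^sup>2)" for T n
    proof (rule integrable_cauchy_law)
      show "continuous_on UNIV (\<lambda>t. (cmod (g n (Complex \<sigma> t)))\<^sup>2)"
        by (intro continuous_intros continuous_on_vertical_line[OF hol_g \<sigma>])
      show "norm ((cmod (g n (Complex \<sigma> t)))\<^sup>2) \<le> (real n powr (- 1 / 2))\<^sup>2" for t
        unfolding g_def using symbol_power_bound[OF \<phi>, of "Complex \<sigma> t" n] \<sigma>
        by (simp add: half_plane_def power_mono)
    qed
    have int_h: "integrable (cauchy_law T) (\<lambda>t. h j (Complex \<sigma> t))" for T j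
      using \<sigma> by (intro integrable_cauchy_law[where K = "1 / \<eta>"] continuous_on_vertical_line[OF hol_h] norm_h') auto
    have mean_h: "(LINT t|cauchy_law T. Re (h j (Complex \<sigma> t))) = Re (h j (of_real (\<sigma> + T)))" if "T > 0" for T j
    proof -
      have "(LINT t|cauchy_law T. h j (Complex \<sigma> t)) = h j (of_real (\<sigma> + T))"
      proof (rule integral_cauchy_law_vertical_line[OF _ _ _ that])
        show "continuous_on {s. Re s \<ge> \<sigma>} (h j)"
          by (rule holomorphic_on_imp_continuous_on, rule holomorphic_on_subset[OF hol_h])
             (use \<sigma> in \<open>auto simp: half_plane_def\<close>)
        show "h j holomorphic_on half_plane \<sigma>"
          by (rule holomorphic_on_subset[OF hol_h]) (use \<sigma> in \<open>auto simp: half_plane_def\<close>)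
        show "cmod (h j s) \<le> 1 / \<eta>" if "Re s \<ge> \<sigma>" for s
          using that \<sigma> by (intro norm_h') auto
      qed
      then show ?thesis using int_h by simp
    qed
    have int_Re_h: "integrable (cauchy_law T) (\<lambda>t. Re (h j (Complex \<sigma> t)) / (2 * (cos (\<alpha> j))\<^sup>2))" for T j
      by (rule integrable_divide, rule integrable_Re, rule int_h)
    note int_const = finite_measure.integrable_const[OF finite_measure_cauchy_law]
    have int_U: "integrable (cauchy_law T) (\<lambda>t. U (Complex \<sigma> t))" for T
      unfolding U_def
      by (rule integrable_mult_right, rule Bochner_Integration.integrable_add[OF int_const],
          rule Bochner_Integration.integrable_sum, rule int_Re_h)
    have mean_U: "(LINT t|cauchy_law T. U (Complex \<sigma> t)) = U (of_real (\<sigma> + T))" if "T > 0" for T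
    proof -
      have "(LINT t|cauchy_law T. (\<Sum>j=1..d. Re (h j (Complex \<sigma> t)) / (2 * (cos (\<alpha> j))\<^sup>2)))
          = (\<Sum>j=1..d. LINT t|cauchy_law T. Re (h j (Complex \<sigma> t)) / (2 * (cos (\<alpha> j))\<^sup>2))"
        by (rule Bochner_Integration.integral_sum) (rule int_Re_h)
      also have "\<dots> = (\<Sum>j=1..d. Re (h j (of_real (\<sigma> + T))) / (2 * (cos (\<alpha> j))\<^sup>2))"
        by (simp only: integral_divide_zero mean_h[OF that])
      finally have "(LINT t|cauchy_law T. 1 + 1 / (2 * \<delta>) + (\<Sum>j=1..d. Re (h j (Complex \<sigma> t)) / (2 * (cos (\<alpha> j))\<^sup>2)))
          = 1 + 1 / (2 * \<delta>) + (\<Sum>j=1..d. Re (h j (of_real (\<sigma> + T))) / (2 * (cos (\<alpha> j))\<^sup>2))"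
        by (subst Bochner_Integration.integral_add[OF int_const])
           (auto intro!: Bochner_Integration.integrable_sum int_Re_h simp del: integral_Re)
      then show ?thesis unfolding U_def integral_mult_right_zero by simp
    qed
    have "\<forall>\<^sub>F T in at_top. Re (\<phi> (of_real (\<sigma> + T))) \<ge> \<kappa>"
      using \<kappa>(2) filterlim_tendsto_add_at_top[OF tendsto_const[of \<sigma>] filterlim_ident]
      by (rule eventually_compose_filterlim)
    then have ev: "\<forall>\<^sub>F T in at_top. (\<Sum>n=1..N. \<Sum>m=1..M. (cmod (b n m))\<^sup>2 * real m powr (-2 * \<sigma>))
        \<le> real (N + 1) powr (2 * \<eta>) * C + (\<Sum>n=1..N. E n T)"
      using eventually_gt_at_top[of 0]
    proof eventually_elim
      case (elim T)
      have "Re (h j (of_real (\<sigma> + T))) \<le> 1 / (\<kappa> - 1 / 2)" for j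
      proof -
        have "Re (h j (of_real (\<sigma> + T))) \<le> 1 / Re (\<phi> (of_real (\<sigma> + T)) - w j + of_real \<eta>)"
          using elim \<sigma> by (intro order.trans[OF complex_Re_le_cmod norm_h]) auto
        also have "\<dots> \<le> 1 / (\<kappa> - 1 / 2)"
          using elim \<kappa>(1) \<eta> by (intro divide_left_mono mult_pos_pos) (auto simp: w_def)
        finally show ?thesis .
      qed
      then have U_le: "U (of_real (\<sigma> + T)) \<le> real (N + 1) powr (2 * \<eta>) * C"
        unfolding U_def C_def using \<delta> by (intro mult_left_mono add_mono sum_mono divide_right_mono) auto
      have "(\<Sum>n=1..N. \<Sum>m=1..M. (cmod (b n m))\<^sup>2 * real m powr (-2 * \<sigma>))
        \<le> (\<Sum>n=1..N. (LINT t|cauchy_law T. (cmod (g n (Complex \<sigma> t)))\<^sup>2) + E n T)"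
        by (intro sum_mono E)
      also have "\<dots> = (LINT t|cauchy_law T. (\<Sum>n=1..N. (cmod (g n (Complex \<sigma> t)))\<^sup>2)) + (\<Sum>n=1..N. E n T)"
        using int_g by (simp add: sum.distrib Bochner_Integration.integral_sum)
      also have "(LINT t|cauchy_law T. (\<Sum>n=1..N. (cmod (g n (Complex \<sigma> t)))\<^sup>2)) \<le> (LINT t|cauchy_law T. U (Complex \<sigma> t))"
        using int_g int_U pointwise \<sigma> by (intro integral_mono Bochner_Integration.integrable_sum) auto
      also have "\<dots> \<le> real (N + 1) powr (2 * \<eta>) * C"
        using mean_U[of T] U_le elim by simp
      finally show ?case by simp
    qed
    have "((\<lambda>T. real (N + 1) powr (2 * \<eta>) * C + (\<Sum>n=1..N. E n T)) \<longlongrightarrow> real (N + 1) powr (2 * \<eta>) * C + (\<Sum>n=1..N. 0)) at_top"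
      by (intro tendsto_intros E)
    from tendsto_lowerbound[OF this ev] show ?thesis by simp
  qed
  \<comment> \<open>The parameters \<open>\<eta>\<close> and \<open>\<sigma>\<close> tend to \<open>0\<close> together.\<close>
  have "(\<Sum>n=1..N. \<Sum>m=1..M. (cmod (b n m))\<^sup>2) \<le> C" for N M
  proof (rule tendsto_le[of "at_right (0::real)"])
    have "((\<lambda>\<eta>. real (N + 1) powr (2 * \<eta>) * C) \<longlongrightarrow> real (N + 1) powr (2 * 0) * C) (at_right 0)"
      by (intro tendsto_intros) auto
    then show "((\<lambda>\<eta>. real (N + 1) powr (2 * \<eta>) * C) \<longlongrightarrow> C) (at_right 0)" by simp
    have "((\<lambda>\<sigma>. \<Sum>n=1..N. \<Sum>m=1..M. (cmod (b n m))\<^sup>2 * real m powr (-2 * \<sigma>))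
        \<longlongrightarrow> (\<Sum>n=1..N. \<Sum>m=1..M. (cmod (b n m))\<^sup>2 * real m powr (-2 * 0))) (at_right 0)"
      by (intro tendsto_intros) auto
    also have "(\<Sum>n=1..N. \<Sum>m=1..M. (cmod (b n m))\<^sup>2 * real m powr (-2 * 0)) = (\<Sum>n=1..N. \<Sum>m=1..M. (cmod (b n m))\<^sup>2)"
      by (intro sum.cong) auto
    finally show "((\<lambda>\<sigma>. \<Sum>n=1..N. \<Sum>m=1..M. (cmod (b n m))\<^sup>2 * real m powr (-2 * \<sigma>))
        \<longlongrightarrow> (\<Sum>n=1..N. \<Sum>m=1..M. (cmod (b n m))\<^sup>2)) (at_right 0)" .
    show "\<forall>\<^sub>F \<sigma> in at_right 0. (\<Sum>n=1..N. \<Sum>m=1..M. (cmod (b n m))\<^sup>2 * real m powr (-2 * \<sigma>))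
        \<le> real (N + 1) powr (2 * \<sigma>) * C"
      using eventually_at_right_less[of 0] by eventually_elim (rule bound)
  qed simp
  then show ?thesis by blast
qed

section \<open>Hilbert--Schmidt matrices are compact operators\<close>

lemma h2_coeff_add: "h2_coeff (f + g) n = h2_coeff f n + h2_coeff g n"
  and h2_coeff_scaleR: "h2_coeff (r *\<^sub>R f) n = r *\<^sub>R h2_coeff f n"
  by (transfer, simp)+

lemma norm_h2_power2: "(norm f)\<^sup>2 = (\<Sum>n. (cmod (h2_coeff f n))\<^sup>2)" for f :: h2
  unfolding norm_h2_def by (intro real_sqrt_pow2 suminf_nonneg summable_h2_coeff) simp

lemma l2_summable_mult:
  fixes a b :: "nat \<Rightarrow> complex"
  assumes "summable (\<lambda>n. (cmod (a n))\<^sup>2)" "summable (\<lambda>n. (cmod (b n))\<^sup>2)"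
  shows "summable (\<lambda>n. a n * b n)"
proof (rule summable_comparison_test'[OF summable_add[OF assms], of 0])
  fix n
  show "norm (a n * b n) \<le> (cmod (a n))\<^sup>2 + (cmod (b n))\<^sup>2"
    using sum_squares_bound[of "cmod (a n)" "cmod (b n)"]
      mult_nonneg_nonneg[OF norm_ge_zero[of "a n"] norm_ge_zero[of "b n"]]
    unfolding norm_mult by linarith
qed

lemma l2_cauchy_schwarz:
  fixes a b :: "nat \<Rightarrow> complex"
  assumes "summable (\<lambda>n. (cmod (a n))\<^sup>2)" "summable (\<lambda>n. (cmod (b n))\<^sup>2)"
  shows "(cmod (\<Sum>n. a n * b n))\<^sup>2 \<le> (\<Sum>n. (cmod (a n))\<^sup>2) * (\<Sum>n. (cmod (b n))\<^sup>2)"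
proof (rule LIMSEQ_le_const2)
  show "(\<lambda>N. (cmod (\<Sum>n<N. a n * b n))\<^sup>2) \<longlonglongrightarrow> (cmod (\<Sum>n. a n * b n))\<^sup>2"
    by (intro tendsto_intros summable_LIMSEQ l2_summable_mult assms)
  have "(cmod (\<Sum>n<N. a n * b n))\<^sup>2 \<le> (\<Sum>n. (cmod (a n))\<^sup>2) * (\<Sum>n. (cmod (b n))\<^sup>2)" for N
  proof -
    have "cmod (\<Sum>n<N. a n * b n) \<le> (\<Sum>n<N. cmod (a n) * cmod (b n))"
      by (rule sum_norm_le) (simp add: norm_mult)
    then have "(cmod (\<Sum>n<N. a n * b n))\<^sup>2 \<le> (\<Sum>n<N. cmod (a n) * cmod (b n))\<^sup>2"
      by (intro power_mono) auto
    also have "\<dots> \<le> (\<Sum>n<N. (cmod (a n))\<^sup>2) * (\<Sum>n<N. (cmod (b n))\<^sup>2)"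
      by (rule Cauchy_Schwarz_ineq_sum)
    also have "\<dots> \<le> (\<Sum>n. (cmod (a n))\<^sup>2) * (\<Sum>n. (cmod (b n))\<^sup>2)"
      using assms by (intro mult_mono sum_le_suminf sum_nonneg suminf_nonneg) auto
    finally show ?thesis .
  qed
  then show "\<exists>N. \<forall>n\<ge>N. (cmod (\<Sum>n<n. a n * b n))\<^sup>2 \<le> (\<Sum>n. (cmod (a n))\<^sup>2) * (\<Sum>n. (cmod (b n))\<^sup>2)"
    by blast
qed

lemma compact_Pi_complex:
  fixes K :: "'i \<Rightarrow> complex set"
  assumes "\<And>i. compact (K i)"
  shows "compact {x. \<forall>i. x i \<in> K i}"
proof -
  have "compactin (product_topology (\<lambda>i. euclidean) UNIV) (PiE UNIV K)"
    using assms by (simp add: compactin_PiE)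
  then have "compact (PiE UNIV K)"
    by (simp add: euclidean_product_topology)
  also have "PiE UNIV K = {x. \<forall>i. x i \<in> K i}" by (auto simp: PiE_def Pi_def)
  finally show ?thesis .
qed

text \<open>
  The cube is the image of a product of discs, compact by Tychonoff's theorem, under the map that turns
  a sequence into an element of \<^typ>\<open>h2\<close>. On the cube the distance is a uniformly convergent series of
  continuous functions of the coordinates, so this map is continuous.
\<close>

lemma compact_hilbert_cube:
  assumes \<beta>: "summable \<beta>"
  shows "compact {f :: h2. \<forall>n. (cmod (h2_coeff f n))\<^sup>2 \<le> \<beta> n}"
proof (cases "\<forall>n. \<beta> n \<ge> 0")
  case False
  then obtain n where "\<beta> n < 0" by (auto simp: not_le)
  then have "\<not> (cmod z)\<^sup>2 \<le> \<beta> n" for z using zero_le_power2[of "cmod z"] by linarith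
  then have "{f :: h2. \<forall>n. (cmod (h2_coeff f n))\<^sup>2 \<le> \<beta> n} = {}" by blast
  then show ?thesis by (simp only: compact_empty)
next
  case True
  \<comment> \<open>The coordinate with index \<open>0\<close> vanishes for elements of \<^typ>\<open>h2\<close>.\<close>
  define K where "K = {x :: nat \<Rightarrow> complex. \<forall>n. x n \<in> cball 0 (if n = 0 then 0 else sqrt (\<beta> n))}"
  have K_le: "(cmod (x n))\<^sup>2 \<le> \<beta> n" if "x \<in> K" for x n
  proof -
    have "cmod (x n) \<le> sqrt (\<beta> n)"
      using that[unfolded K_def, simplified, rule_format, of n] True by (cases "n = 0") auto
    then have "(cmod (x n))\<^sup>2 \<le> (sqrt (\<beta> n))\<^sup>2" by (intro power_mono) auto
    then show ?thesis using True by simp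
  qed
  have coeff: "h2_coeff (Abs_h2 x) = x" if "x \<in> K" for x
  proof (rule Abs_h2_inverse)
    have "x 0 = 0" using that[unfolded K_def, simplified, rule_format, of 0] by simp
    moreover have "summable (\<lambda>n. (cmod (x n))\<^sup>2)"
      using K_le[OF that] by (intro summable_comparison_test'[OF \<beta>, of 0]) auto
    ultimately show "x \<in> {a. a 0 = 0 \<and> summable (\<lambda>n. (cmod (a n))\<^sup>2)}" by simp
  qed
  have dist: "dist (Abs_h2 x) (Abs_h2 y) = sqrt (\<Sum>n. (cmod (x n - y n))\<^sup>2)" if "x \<in> K" "y \<in> K" for x y
    using that by (simp add: dist_norm norm_h2_def h2_coeff_diff coeff)
  have "continuous_on K Abs_h2"
    unfolding continuous_on_def
  proof
    fix y assume y: "y \<in> K"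
    have "uniform_limit K (\<lambda>N x. \<Sum>n<N. (cmod (x n - y n))\<^sup>2) (\<lambda>x. \<Sum>n. (cmod (x n - y n))\<^sup>2) sequentially"
    proof (rule Weierstrass_m_test)
      show "summable (\<lambda>n. 4 * \<beta> n)" using \<beta> by (rule summable_mult)
      fix n x assume x: "x \<in> K"
      show "norm ((cmod (x n - y n))\<^sup>2) \<le> 4 * \<beta> n"
        using cmod_add_square_le[of "x n" "- y n"] K_le[OF x, of n] K_le[OF y, of n] by simp
    qed
    moreover have "continuous_on K (\<lambda>x. \<Sum>n<N. (cmod (x n - y n))\<^sup>2)" for N
      by (intro continuous_intros continuous_on_subset[OF continuous_on_product_coordinates]) auto
    ultimately have "continuous_on K (\<lambda>x. \<Sum>n. (cmod (x n - y n))\<^sup>2)"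
      by (intro uniform_limit_theorem[where F = sequentially]) auto
    then have "continuous_on K (\<lambda>x. sqrt (\<Sum>n. (cmod (x n - y n))\<^sup>2))"
      by (rule continuous_on_real_sqrt)
    then have "((\<lambda>x. sqrt (\<Sum>n. (cmod (x n - y n))\<^sup>2)) \<longlongrightarrow> 0) (at y within K)"
      using y by (auto simp: continuous_on_def)
    moreover have "\<forall>\<^sub>F x in at y within K. sqrt (\<Sum>n. (cmod (x n - y n))\<^sup>2) = dist (Abs_h2 x) (Abs_h2 y)"
      unfolding eventually_at_filter using dist y by (intro always_eventually) simp
    ultimately have "((\<lambda>x. dist (Abs_h2 x) (Abs_h2 y)) \<longlongrightarrow> 0) (at y within K)"
      by (rule Lim_transform_eventually)
    then show "(Abs_h2 \<longlongrightarrow> Abs_h2 y) (at y within K)" by (rule tendsto_dist_iff[THEN iffD2])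
  qed
  moreover have "compact K" unfolding K_def by (rule compact_Pi_complex) simp
  ultimately have "compact (Abs_h2 ` K)" by (rule compact_continuous_image)
  also have "Abs_h2 ` K = {f. \<forall>n. (cmod (h2_coeff f n))\<^sup>2 \<le> \<beta> n}"
  proof (intro equalityI subsetI)
    fix f assume "f \<in> Abs_h2 ` K"
    then show "f \<in> {f. \<forall>n. (cmod (h2_coeff f n))\<^sup>2 \<le> \<beta> n}" using coeff K_le by auto
  next
    fix f assume "f \<in> {f. \<forall>n. (cmod (h2_coeff f n))\<^sup>2 \<le> \<beta> n}"
    then have "h2_coeff f \<in> K" by (auto simp: K_def intro: real_le_rsqrt)
    then show "f \<in> Abs_h2 ` K" using h2_coeff_inverse[of f] by (metis imageI)
  qed
  finally show ?thesis .
qed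

definition matrix_operator :: "(nat \<Rightarrow> nat \<Rightarrow> complex) \<Rightarrow> h2 \<Rightarrow> h2" where
  "matrix_operator b f = Abs_h2 (\<lambda>m. \<Sum>n. h2_coeff f n * b n m)"

text \<open>
  Hilbert--Schmidt matrices: the sum of the squares of all entries is finite. It is expressed by finite
  rectangular sums, as they come out of Bessel's inequality.
\<close>

context
  fixes b :: "nat \<Rightarrow> nat \<Rightarrow> complex" and C :: real
  assumes b0: "\<And>m. b 0 m = 0" "\<And>n. b n 0 = 0"
    and HS: "\<And>N M. (\<Sum>n=1..N. \<Sum>m=1..M. (cmod (b n m))\<^sup>2) \<le> C"
begin

lemma hilbert_schmidt_summable: "(\<lambda>(n, m). (cmod (b n m))\<^sup>2) summable_on UNIV \<times> UNIV"
proof (rule nonneg_bdd_above_summable_on)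
  show "bdd_above (sum (\<lambda>(n, m). (cmod (b n m))\<^sup>2) ` {F. F \<subseteq> UNIV \<times> UNIV \<and> finite F})"
  proof (rule bdd_aboveI2)
    fix F :: "(nat \<times> nat) set" assume "F \<in> {F. F \<subseteq> UNIV \<times> UNIV \<and> finite F}"
    then have F: "finite F" by simp
    define N where "N = Max (insert 0 (fst ` F))"
    define M where "M = Max (insert 0 (snd ` F))"
    have "F \<subseteq> {..N} \<times> {..M}"
    proof
      fix p assume "p \<in> F"
      then have "fst p \<le> N" "snd p \<le> M"
        using F by (auto simp: N_def M_def intro!: Max_ge)
      then show "p \<in> {..N} \<times> {..M}" by (cases p) auto
    qed
    then have "(\<Sum>(n, m)\<in>F. (cmod (b n m))\<^sup>2) \<le> (\<Sum>(n, m)\<in>{..N} \<times> {..M}. (cmod (b n m))\<^sup>2)"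
      by (intro sum_mono2) auto
    also have "\<dots> = (\<Sum>(n, m)\<in>{1..N} \<times> {1..M}. (cmod (b n m))\<^sup>2)"
      by (rule sum.mono_neutral_right) (auto simp: b0 Suc_le_eq intro!: gr0I)
    also have "\<dots> = (\<Sum>n=1..N. \<Sum>m=1..M. (cmod (b n m))\<^sup>2)"
      by (rule sum.cartesian_product[symmetric])
    also have "\<dots> \<le> C" by (rule HS)
    finally show "(\<Sum>(n, m)\<in>F. (cmod (b n m))\<^sup>2) \<le> C" .
  qed
qed auto

lemma summable_row: "summable (\<lambda>m. (cmod (b n m))\<^sup>2)"
  using summable_on_SigmaD1[OF hilbert_schmidt_summable, of n] by (intro summable_on_imp_summable) auto

lemma hilbert_schmidt_summable_swap: "(\<lambda>(m, n). (cmod (b n m))\<^sup>2) summable_on UNIV \<times> UNIV"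
  using hilbert_schmidt_summable by (subst (asm) summable_on_swap) simp

lemma summable_column: "summable (\<lambda>n. (cmod (b n m))\<^sup>2)"
  using summable_on_SigmaD1[OF hilbert_schmidt_summable_swap, of m] by (intro summable_on_imp_summable) auto

lemma summable_column_norms: "summable (\<lambda>m. \<Sum>n. (cmod (b n m))\<^sup>2)"
proof -
  have "(\<lambda>n. (cmod (b n m))\<^sup>2) summable_on UNIV" for m
    using summable_column by (intro norm_summable_imp_summable_on) auto
  then have "((\<lambda>n. (cmod (b n m))\<^sup>2) has_sum (\<Sum>n. (cmod (b n m))\<^sup>2)) UNIV" for m
    using summable_column by (intro norm_summable_imp_has_sum summable_sums) auto
  then have "infsum (\<lambda>n. (cmod (b n m))\<^sup>2) UNIV = (\<Sum>n. (cmod (b n m))\<^sup>2)" for m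
    by (rule infsumI)
  then show ?thesis
    using summable_on_Sigma_banach[OF hilbert_schmidt_summable_swap] by (auto intro: summable_on_imp_summable)
qed

lemma matrix_operator_coeff_bound:
  "(cmod (\<Sum>n. h2_coeff f n * b n m))\<^sup>2 \<le> (norm f)\<^sup>2 * (\<Sum>n. (cmod (b n m))\<^sup>2)"
  unfolding norm_h2_power2 by (intro l2_cauchy_schwarz summable_h2_coeff summable_column)

lemma h2_coeff_matrix_operator: "h2_coeff (matrix_operator b f) m = (\<Sum>n. h2_coeff f n * b n m)"
proof -
  have "summable (\<lambda>m. (cmod (\<Sum>n. h2_coeff f n * b n m))\<^sup>2)"
    using matrix_operator_coeff_bound
    by (intro summable_comparison_test'[OF summable_mult[OF summable_column_norms, of "(norm f)\<^sup>2"], of 0]) auto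
  then show ?thesis unfolding matrix_operator_def by (subst Abs_h2_inverse) (auto simp: b0)
qed

text \<open>
  By the Cauchy--Schwarz inequality the \<open>m\<close>-th coefficient of the image of a unit vector is bounded by the
  norm of the \<open>m\<close>-th column. These norms are square summable, so the unit ball is mapped into a
  Hilbert cube.
\<close>

lemma compact_matrix_operator: "compact_operator (matrix_operator b)"
proof -
  note summ = l2_summable_mult[OF summable_h2_coeff summable_column]
  define B where "B = (\<Sum>m. \<Sum>n. (cmod (b n m))\<^sup>2)"
  have lin: "bounded_linear (matrix_operator b)"
  proof (rule bounded_linear_intro)
    show "matrix_operator b (f + g) = matrix_operator b f + matrix_operator b g" for f g
      by (rule h2_eqI) (simp add: h2_coeff_matrix_operator h2_coeff_add distrib_right suminf_add[OF summ summ])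
    show "matrix_operator b (r *\<^sub>R f) = r *\<^sub>R matrix_operator b f" for r f
      by (rule h2_eqI) (simp add: h2_coeff_matrix_operator h2_coeff_scaleR suminf_scaleR_right[OF summ])
    show "norm (matrix_operator b f) \<le> norm f * sqrt B" for f
    proof (rule power2_le_imp_le)
      have "(norm (matrix_operator b f))\<^sup>2 \<le> (\<Sum>m. (norm f)\<^sup>2 * (\<Sum>n. (cmod (b n m))\<^sup>2))"
        unfolding norm_h2_power2[of "matrix_operator b f"]
        by (intro suminf_le summable_h2_coeff summable_mult summable_column_norms)
           (simp add: h2_coeff_matrix_operator matrix_operator_coeff_bound)
      also have "\<dots> = (norm f)\<^sup>2 * B"
        unfolding B_def by (rule suminf_mult[OF summable_column_norms])
      also have "\<dots> = (norm f * sqrt B)\<^sup>2"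
        unfolding B_def power_mult_distrib
        by (subst real_sqrt_pow2) (auto intro!: suminf_nonneg summable_column_norms summable_column)
      finally show "(norm (matrix_operator b f))\<^sup>2 \<le> (norm f * sqrt B)\<^sup>2" .
      show "0 \<le> norm f * sqrt B"
        unfolding B_def by (auto intro!: mult_nonneg_nonneg suminf_nonneg summable_column_norms summable_column)
    qed
  qed
  define Q where "Q = {f. \<forall>m. (cmod (h2_coeff f m))\<^sup>2 \<le> (\<Sum>n. (cmod (b n m))\<^sup>2)}"
  have "matrix_operator b ` cball 0 1 \<subseteq> Q"
  proof
    fix h assume "h \<in> matrix_operator b ` cball 0 1"
    then obtain f where f: "norm f \<le> 1" and h: "h = matrix_operator b f" by auto
    have "(cmod (h2_coeff h m))\<^sup>2 \<le> 1 * (\<Sum>n. (cmod (b n m))\<^sup>2)" for m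
    proof -
      have "(cmod (h2_coeff h m))\<^sup>2 \<le> (norm f)\<^sup>2 * (\<Sum>n. (cmod (b n m))\<^sup>2)"
        unfolding h h2_coeff_matrix_operator by (rule matrix_operator_coeff_bound)
      also have "\<dots> \<le> 1 * (\<Sum>n. (cmod (b n m))\<^sup>2)"
        using f by (intro mult_right_mono suminf_nonneg summable_column) (auto simp: power_le_one)
      finally show ?thesis .
    qed
    then show "h \<in> Q" by (simp add: Q_def)
  qed
  moreover have "compact Q"
    unfolding Q_def by (rule compact_hilbert_cube[OF summable_column_norms])
  ultimately have "Q \<inter> closure (matrix_operator b ` cball 0 1) = closure (matrix_operator b ` cball 0 1)"
    by (intro inf.absorb2 closure_minimal compact_imp_closed)
  with compact_Int_closed[OF \<open>compact Q\<close> closed_closure]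
  have "compact (closure (matrix_operator b ` cball 0 1))" by metis
  with lin show ?thesis by (simp add: compact_operator_def)
qed

text \<open>
  Expanding \<open>f\<close>, with coefficients \<open>a n\<close>, at \<open>z\<close> and each \<open>n powr (- z)\<close> at \<open>s\<close> gives a double series, whose order of summation is
  exchanged. It converges absolutely because \<open>2 x y \<le> x\<^sup>2 + y\<^sup>2\<close> dominates its terms by
  \<open>\<bar>b n m\<bar>\<^sup>2 + \<bar>a n\<bar>\<^sup>2 m powr (- 2 Re s)\<close>, and \<open>2 Re s > 1\<close>.
\<close>

lemma h2_fun_matrix_operator:
  assumes s: "Re s > 1 / 2"
    and rows: "\<And>n. (dirichlet_term (b n) s has_sum of_nat n powr (- z)) UNIV"
    and z: "Re z > 1 / 2"
  shows "h2_fun (matrix_operator b f) s = h2_fun f z"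
proof -
  define a where "a = h2_coeff f"
  define x where "x = Re s"
  define t where "t = (\<lambda>(n, m). a n * dirichlet_term (b n) s m)"
  have a: "summable (\<lambda>n. (cmod (a n))\<^sup>2)" unfolding a_def by (rule summable_h2_coeff)
  have dom: "(\<lambda>(n, m). (cmod (b n m))\<^sup>2 + (cmod (a n))\<^sup>2 * real m powr (-2 * x)) summable_on UNIV \<times> UNIV"
  proof -
    define Z where "Z = (\<Sum>m. real m powr (-2 * x))"
    have "summable (\<lambda>m. real m powr (-2 * x))" using s by (simp add: summable_real_powr_iff x_def)
    then have Z: "((\<lambda>m. real m powr (-2 * x)) has_sum Z) UNIV"
      unfolding Z_def by (intro norm_summable_imp_has_sum summable_sums) auto
    have "(\<lambda>n. (cmod (a n))\<^sup>2) summable_on UNIV"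
      using a by (intro norm_summable_imp_summable_on) auto
    then have "(\<lambda>(n, m). (cmod (a n))\<^sup>2 * real m powr (-2 * x)) summable_on UNIV \<times> UNIV"
    proof (intro summable_on_SigmaI[where g = "\<lambda>n. (cmod (a n))\<^sup>2 * Z"] summable_on_cmult_left)
      show "((\<lambda>m. case (n, m) of (n, m) \<Rightarrow> (cmod (a n))\<^sup>2 * real m powr (-2 * x)) has_sum (cmod (a n))\<^sup>2 * Z) UNIV" for n
        unfolding prod.case by (rule has_sum_cmult_right[OF Z])
    qed auto
    from summable_on_add[OF hilbert_schmidt_summable this]
    show ?thesis by (simp add: case_prod_unfold)
  qed
  have "(\<lambda>p. norm (t p)) summable_on UNIV \<times> UNIV"
  proof (rule summable_on_comparison_test[OF dom])
    fix p :: "nat \<times> nat"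
    obtain n m where p: "p = (n, m)" by fastforce
    have "norm (t p) = cmod (b n m) * (cmod (a n) * real m powr (- x))"
      by (simp add: t_def p norm_mult norm_dirichlet_term x_def)
    also have "\<dots> \<le> (cmod (b n m))\<^sup>2 + (cmod (a n) * real m powr (- x))\<^sup>2"
      using sum_squares_bound[of "cmod (b n m)" "cmod (a n) * real m powr (- x)"]
        mult_nonneg_nonneg[of "cmod (b n m)" "cmod (a n) * real m powr (- x)"]
        mult_nonneg_nonneg[of "cmod (a n)" "real m powr (- x)"]
      by (simp only: norm_ge_zero powr_ge_zero True_implies_equals)
    also have "(cmod (a n) * real m powr (- x))\<^sup>2 = (cmod (a n))\<^sup>2 * real m powr (-2 * x)"
      unfolding power_mult_distrib by (simp add: power2_eq_square flip: powr_add)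
    finally show "norm (t p) \<le> (case p of (n, m) \<Rightarrow> (cmod (b n m))\<^sup>2 + (cmod (a n))\<^sup>2 * real m powr (-2 * x))"
      by (simp add: p)
  qed auto
  then have "t summable_on UNIV \<times> UNIV" by (rule abs_summable_summable)
  then obtain S where S: "(t has_sum S) (UNIV \<times> UNIV)" by (auto simp: summable_on_def)
  have "((\<lambda>n. a n * of_nat n powr (- z)) has_sum S) UNIV"
    by (rule has_sum_SigmaD[OF S]) (auto simp: t_def intro!: has_sum_cmult_right rows)
  then have "(dirichlet_term (h2_coeff f) z has_sum S) UNIV"
    by (simp add: dirichlet_term_def[abs_def] a_def)
  then have "S = h2_fun f z" using h2_fun_has_sum[OF z] by (rule has_sum_unique)
  have S': "((\<lambda>(m, n). t (n, m)) has_sum S) (UNIV \<times> UNIV)"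
    using S by (subst (asm) has_sum_swap) (simp add: case_prod_unfold)
  have "(dirichlet_term (h2_coeff (matrix_operator b f)) s has_sum S) UNIV"
  proof (rule has_sum_SigmaD[OF S'])
    fix m
    have "((\<lambda>n. a n * b n m) has_sum h2_coeff (matrix_operator b f) m) UNIV"
      unfolding h2_coeff_matrix_operator a_def
    proof (rule norm_summable_imp_has_sum)
      show "summable (\<lambda>n. norm (h2_coeff f n * b n m))"
        using l2_summable_mult[of "\<lambda>n. of_real (cmod (h2_coeff f n))" "\<lambda>n. of_real (cmod (b n m))"]
          summable_h2_coeff[of f] summable_column[of m]
        by (simp add: norm_mult summable_complex_of_real flip: of_real_mult)
      show "(\<lambda>n. h2_coeff f n * b n m) sums (\<Sum>n. h2_coeff f n * b n m)"
        by (intro summable_sums l2_summable_mult summable_h2_coeff summable_column)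
    qed
    from has_sum_cmult_left[OF this, of "of_nat m powr (- s)"]
    show "((\<lambda>n. case (m, n) of (m, n) \<Rightarrow> t (n, m)) has_sum dirichlet_term (h2_coeff (matrix_operator b f)) s m) UNIV"
      by (simp add: t_def dirichlet_term_def mult.assoc)
  qed
  then have "S = h2_fun (matrix_operator b f) s" using h2_fun_has_sum[OF s] by (rule has_sum_unique)
  with \<open>S = h2_fun f z\<close> show ?thesis by simp
qed

end

section \<open>Compactness of the composition operator\<close>

theorem theorem4p3:
  fixes \<phi> :: "complex \<Rightarrow> complex" and \<delta> :: real
    and d :: nat and \<tau> \<alpha> :: "nat \<Rightarrow> real"
  assumes "\<phi> \<in> symbol_class_G0"
    and "\<delta> > 0"
    and "\<And>j. j \<in> {1..d} \<Longrightarrow> 0 < \<alpha> j \<and> \<alpha> j < pi / 2"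
    and "\<phi> ` half_plane 0 \<inter> {s. 1 / 2 < Re s \<and> Re s \<le> 1 / 2 + \<delta>}
           \<subseteq> (\<Union>j\<in>{1..d}. angular_sector (Complex (1 / 2) (\<tau> j)) (\<alpha> j))"
  shows "(\<forall>f. \<forall>s\<in>half_plane (1 / 2).
            h2_fun (composition_operator \<phi> f) s = h2_fun f (\<phi> s))
         \<and> compact_operator (composition_operator \<phi>)"
proof -
  from symbol_powers_dirichlet[OF assms(1)] obtain \<theta> b
    where b0: "\<And>m. b 0 m = 0" "\<And>n. b n 0 = 0"
      and b: "\<And>n s. Re s \<ge> \<theta> \<Longrightarrow> (dirichlet_term (b n) s has_sum of_nat n powr (- \<phi> s)) UNIV"
    by blast
  from symbol_hilbert_schmidt[OF assms b] obtain C
    where HS: "\<And>N M. (\<Sum>n=1..N. \<Sum>m=1..M. (cmod (b n m))\<^sup>2) \<le> C" by blast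
  have hol: "\<phi> holomorphic_on half_plane (1 / 2)"
    using assms(1) by (auto simp: symbol_class_G0_def half_plane_def elim!: holomorphic_on_subset)
  \<comment> \<open>The rows are square summable, so their series converge on \<open>half_plane (1 / 2)\<close>; the identity theorem carries the equation over from the far right.\<close>
  have rows: "(dirichlet_term (b n) s has_sum of_nat n powr (- \<phi> s)) UNIV" if s: "Re s > 1 / 2" for n s
  proof -
    have "dirichlet_series (b n) s = of_nat n powr (- \<phi> s)"
    proof (rule analytic_continuation_open[of "half_plane (max 1 \<theta>)" "half_plane (1 / 2)"
          "dirichlet_series (b n)" "\<lambda>s. of_nat n powr (- \<phi> s)"])
      show "half_plane (max 1 \<theta>) \<noteq> {}"
      proof -
        have "of_real (max 1 \<theta> + 1) \<in> half_plane (max 1 \<theta>)" by (auto simp: half_plane_def max_def)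
        then show ?thesis by blast
      qed
      show "connected (half_plane (1 / 2))"
        unfolding half_plane_def by (intro convex_connected convex_halfspace_Re_gt)
      show "dirichlet_series (b n) holomorphic_on half_plane (1 / 2)"
        by (rule l2_dirichlet_holomorphic[OF summable_row[OF b0 HS]])
      show "(\<lambda>s. of_nat n powr (- \<phi> s)) holomorphic_on half_plane (1 / 2)"
        by (intro holomorphic_intros hol)
      show "half_plane (max 1 \<theta>) \<subseteq> half_plane (1 / 2)" "s \<in> half_plane (1 / 2)"
        using s by (auto simp: half_plane_def)
      fix z assume z: "z \<in> half_plane (max 1 \<theta>)"
      have "(dirichlet_term (b n) z has_sum of_nat n powr (- \<phi> z)) UNIV"
        using z by (intro b) (simp add: half_plane_def)
      moreover have "(dirichlet_term (b n) z has_sum dirichlet_series (b n) z) UNIV"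
        using z by (intro l2_dirichlet_has_sum[OF summable_row[OF b0 HS]]) (simp add: half_plane_def)
      ultimately show "dirichlet_series (b n) z = of_nat n powr (- \<phi> z)"
        using has_sum_unique by blast
    qed (rule open_half_plane)+
    then show ?thesis using l2_dirichlet_has_sum[OF summable_row[OF b0 HS] s, of n] by simp
  qed
  have represents: "h2_fun (matrix_operator b f) s = h2_fun f (\<phi> s)" if s: "s \<in> half_plane (1 / 2)" for f s
  proof (rule h2_fun_matrix_operator[OF b0 HS])
    show "Re s > 1 / 2" using s by (simp add: half_plane_def)
    then show "(dirichlet_term (b n) s has_sum of_nat n powr (- \<phi> s)) UNIV" for n by (rule rows)
    have "s \<in> half_plane 0" using s by (simp add: half_plane_def)
    then show "Re (\<phi> s) > 1 / 2" using assms(1) by (auto simp: symbol_class_G0_def half_plane_def)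
  qed
  have "composition_operator \<phi> f = matrix_operator b f" for f
    unfolding composition_operator_def
    by (rule the_equality) (auto simp: represents intro!: h2_fun_inject)
  then have "composition_operator \<phi> = matrix_operator b" by (rule ext)
  then show ?thesis using represents compact_matrix_operator[OF b0 HS] by simp
qed

end
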